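(* Let $A\in\mathbb{R}^{n\times n}$ be symmetric with eigenvalues $\alpha_1\ge\cdots\ge\alpha_n$, $g\in\mathbb{R}^n$ nonzero, $\Delta>0$, and consider the TRS of minimizing $\frac12x^TAx+x^Tg$ subject to $\|x\|\le\Delta$, in the easy case. With the notation of the context, suppose $\|x_{opt}\|=\|x_k\|=\Delta$, $k\in\{1,\ldots,k_{\max}\}$. Let $y=(y_1^T,y_2^T)^T\in\mathbb{R}^{2n}$ ($y_1,y_2\in\mathbb{R}^n$) be a unit-length eigenvector of $M$ associated with $\lambda_{opt}$, and define $$\tilde h_k=-\|g\|(T_k+\lambda_{opt}I)^{-1}e_1,\quad\tilde x_k=Q_k\tilde h_k,\quad\tilde r_k=(A+\lambda_{opt}I)\tilde x_k+g,\quad s_k=\frac{\|A_{opt}^{-1}x_{opt}\|}{\|g\|\,e_1^T(T_k+\lambda_{opt}I)^{-3}e_1}.$$ Then $$\lambda_{opt}-\lambda_k\le s_k\frac{\|\tilde r_k\|}{\|g\|}\sin\angle(y_2,\mathcal{K}_k)\le s_k\frac{2\beta_k\Delta}{\|y_2\|\|g\|}\Big(\frac{\sqrt\kappa-1}{\sqrt\kappa+1}\Big)^{k-1}\sin\angle(y,\widetilde{\mathcal{S}}_k),$$ where $\mathcal{K}_k=\mathcal{K}_k(A,g)$.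
   Context: Norms are Euclidean. $x_{opt}$ is a global minimizer of the TRS with multiplier $\lambda_{opt}\ge0$ ($(A+\lambda_{opt}I)x_{opt}=-g$, $\lambda_{opt}(\Delta-\|x_{opt}\|)=0$, $A+\lambda_{opt}I\succeq0$); easy case: $\lambda_{opt}>-\alpha_n$. $A_{opt}=A+\lambda_{opt}I$, $\kappa=(\alpha_1+\lambda_{opt})/(\alpha_n+\lambda_{opt})$. $M=\begin{pmatrix}-A&gg^T/\Delta^2\\ I&-A\end{pmatrix}$; when $\|x_{opt}\|=\Delta$, $\lambda_{opt}$ is the rightmost eigenvalue of $M$. Lanczos on $A$ with start $g$: $Q_k=[q_1,\ldots,q_k]$ orthonormal basis of $\mathcal{K}_k(A,g)=\mathrm{span}\{g,\ldots,A^{k-1}g\}$, $q_1=g/\|g\|$, $T_k=Q_k^TAQ_k$ tridiagonal, $AQ_k=Q_kT_k+\beta_kq_{k+1}e_k^T$, $k_{\max}$ the first breakdown step. GLTR: $x_k=Q_kh_k$, $h_k$ minimizes $\frac12h^TT_kh+\|g\|h^Te_1$ over $\|h\|\le\Delta$, multiplier $\lambda_k\ge0$ with $(T_k+\lambda_kI)h_k=-\|g\|e_1$, $\lambda_k(\Delta-\|h_k\|)=0$, $T_k+\lambda_kI\succeq0$. $\widetilde{\mathcal{S}}_k$ is the range of $\mathrm{diag}(Q_k,Q_k)\in\mathbb{R}^{2n\times2k}$. For nonzero $p$ and subspace $\mathcal{W}$ with orthonormal basis $W$, $\sin\angle(p,\mathcal{W})=\|(I-WW^T)p\|/\|p\|$.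 *)

theory Defs
  imports Complex_Main "Jordan_Normal_Form.Matrix" "Jordan_Normal_Form.Char_Poly"
    "Jordan_Normal_Form.Gauss_Jordan_Elimination"
begin

definition vnorm :: "real vec \<Rightarrow> real" where
  "vnorm v = sqrt (v \<bullet> v)"

definition minv :: "real mat \<Rightarrow> real mat" where
  "minv B = the (mat_inverse B)"

definition trs_obj :: "real mat \<Rightarrow> real vec \<Rightarrow> real vec \<Rightarrow> real" where
  "trs_obj A g x = (1/2) * (x \<bullet> (A *\<^sub>v x)) + x \<bullet> g"

definition psd :: "nat \<Rightarrow> real mat \<Rightarrow> bool" where
  "psd d B = (\<forall>v \<in> carrier_vec d. v \<bullet> (B *\<^sub>v v) \<ge> 0)"

definition mat_range :: "real mat \<Rightarrow> real vec set" where
  "mat_range W = {W *\<^sub>v c | c. c \<in> carrier_vec (dim_col W)}"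

definition krylov_mat :: "nat \<Rightarrow> real mat \<Rightarrow> real vec \<Rightarrow> nat \<Rightarrow> real mat" where
  "krylov_mat n A g k = mat_of_cols n (map (\<lambda>j. (A ^\<^sub>m j) *\<^sub>v g) [0..<k])"

definition krylov :: "nat \<Rightarrow> real mat \<Rightarrow> real vec \<Rightarrow> nat \<Rightarrow> real vec set" where
  "krylov n A g k = mat_range (krylov_mat n A g k)"

(* first breakdown step of Lanczos: least k \<ge> 1 with K_{k+1} = K_k, i.e. A^k g \<in> K_k *)
definition kmax :: "nat \<Rightarrow> real mat \<Rightarrow> real vec \<Rightarrow> nat" where
  "kmax n A g = (LEAST k. 1 \<le> k \<and> (A ^\<^sub>m k) *\<^sub>v g \<in> krylov n A g k)"

definition first_cols :: "real mat \<Rightarrow> nat \<Rightarrow> real mat" where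
  "first_cols Q j = mat_of_cols (dim_row Q) (map (col Q) [0..<j])"

(* sine of the angle between nonzero p and the subspace with orthonormal basis W *)
definition sin_angle :: "real vec \<Rightarrow> real mat \<Rightarrow> real" where
  "sin_angle p W = vnorm (p - W *\<^sub>v (transpose_mat W *\<^sub>v p)) / vnorm p"

definition Mmat :: "nat \<Rightarrow> real mat \<Rightarrow> real vec \<Rightarrow> real \<Rightarrow> real mat" where
  "Mmat n A g \<Delta> = four_block_mat (- A) ((1 / \<Delta>^2) \<cdot>\<^sub>m mat n n (\<lambda>(i,j). g $ i * g $ j))
                                  (1\<^sub>m n) (- A)"

end

theory Submission
  imports Defs "Jordan_Normal_Form.Spectral_Radius"
begin

text \<open>
  Write \<open>B = A + \<lambda>\<^sub>o\<^sub>p\<^sub>t I\<close>, \<open>C = Q\<^sup>T B Q\<close>, and let \<open>r\<close> be the residual of the Galerkin solution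
  \<open>Q h\<close>, \<open>C h = - \<parallel>g\<parallel> e\<^sub>1\<close>, of \<open>B x = - g\<close>.
  The function \<open>\<lambda> \<mapsto> \<parallel>(T + \<lambda> I)\<^sup>-\<^sup>1 e\<^sub>1\<parallel>\<^sup>2\<close> is convex, so its tangent at \<open>\<lambda>\<^sub>o\<^sub>p\<^sub>t\<close> bounds the gap
  \<open>\<lambda>\<^sub>o\<^sub>p\<^sub>t - \<lambda>\<^sub>k\<close> by a multiple of \<open>\<parallel>x\<parallel>\<^sup>2 - \<parallel>Q h\<parallel>\<^sup>2 \<le> - 2 r \<bullet> B\<^sup>-\<^sup>1 x\<close>. As \<open>r\<close> is orthogonal to
  the Krylov space, only the component of \<open>B\<^sup>-\<^sup>1 x\<close> orthogonal to it matters, and \<open>y\<^sub>2\<close> is a multiple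
  of \<open>B\<^sup>-\<^sup>1 x\<close>.

  By the Lanczos relation \<open>\<parallel>r\<parallel> = \<beta> |h\<^sub>k|\<close>. The last entry of \<open>h\<close> is unaffected by adding to \<open>h\<close>
  polynomials in \<open>C\<close> of degree at most \<open>k - 2\<close> applied to \<open>e\<^sub>1\<close>, so a scaled Chebyshev polynomial
  of \<open>C\<close> gives \<open>|h\<^sub>k| \<le> 2 \<rho>\<^bsup>k-1\<^esup> \<parallel>h\<parallel>\<close>. Finally \<open>\<parallel>h\<parallel> \<le> \<parallel>x\<parallel>\<close> follows from a sign property of the
  inverse of the tridiagonal matrix \<open>C\<close>.
\<close>

section \<open>Inner products and symmetric matrices\<close>

lemma sp_add_left: "dim_vec u = dim_vec w \<Longrightarrow> dim_vec v = dim_vec w \<Longrightarrow> (u + v) \<bullet> w = u \<bullet> w + v \<bullet> (w :: real vec)"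
  by (rule add_scalar_prod_distrib[of _ "dim_vec w"]) (auto intro: carrier_vecI)

lemma sp_add_right: "dim_vec u = dim_vec w \<Longrightarrow> dim_vec v = dim_vec w \<Longrightarrow> w \<bullet> (u + v) = w \<bullet> u + w \<bullet> (v :: real vec)"
  by (rule scalar_prod_add_distrib[of _ "dim_vec w"]) (auto intro: carrier_vecI)

lemma sp_diff_left: "dim_vec u = dim_vec w \<Longrightarrow> dim_vec v = dim_vec w \<Longrightarrow> (u - v) \<bullet> w = u \<bullet> w - v \<bullet> (w :: real vec)"
  by (rule minus_scalar_prod_distrib[of _ "dim_vec w"]) (auto intro: carrier_vecI)

lemma sp_diff_right: "dim_vec u = dim_vec w \<Longrightarrow> dim_vec v = dim_vec w \<Longrightarrow> w \<bullet> (u - v) = w \<bullet> u - w \<bullet> (v :: real vec)"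
  by (rule scalar_prod_minus_distrib[of _ "dim_vec w"]) (auto intro: carrier_vecI)

lemma sp_smult_left: "dim_vec u = dim_vec w \<Longrightarrow> (c \<cdot>\<^sub>v u) \<bullet> w = c * (u \<bullet> (w :: real vec))"
  by simp

lemma sp_smult_right: "dim_vec u = dim_vec w \<Longrightarrow> w \<bullet> (c \<cdot>\<^sub>v u) = c * (w \<bullet> (u :: real vec))"
  by simp

lemma sp_comm: "dim_vec u = dim_vec v \<Longrightarrow> u \<bullet> v = v \<bullet> (u :: real vec)"
  by (rule comm_scalar_prod[of _ "dim_vec u"]) (auto intro: carrier_vecI)

lemma mv_add: "dim_vec u = dim_col A \<Longrightarrow> dim_vec v = dim_col A \<Longrightarrow> A *\<^sub>v (u + v) = A *\<^sub>v u + A *\<^sub>v (v :: real vec)"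
  by (rule mult_add_distrib_mat_vec[of _ "dim_row A" "dim_col A"]) (auto intro: carrier_vecI)

lemma mv_diff: "dim_vec u = dim_col A \<Longrightarrow> dim_vec v = dim_col A \<Longrightarrow> A *\<^sub>v (u - v) = A *\<^sub>v u - A *\<^sub>v (v :: real vec)"
  by (rule mult_minus_distrib_mat_vec[of _ "dim_row A" "dim_col A"]) (auto intro: carrier_vecI)

lemma mv_smult: "dim_vec u = dim_col A \<Longrightarrow> A *\<^sub>v (c \<cdot>\<^sub>v u) = c \<cdot>\<^sub>v (A *\<^sub>v (u :: real vec))"
  by (rule mult_mat_vec[of _ "dim_row A" "dim_col A"]) (auto intro: carrier_vecI)

lemma mv_uminus: "dim_vec u = dim_col A \<Longrightarrow> A *\<^sub>v (- u) = - (A *\<^sub>v (u :: real vec))"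
  by (intro eq_vecI) auto

lemma mv_zero: "A \<in> carrier_mat m n \<Longrightarrow> A *\<^sub>v 0\<^sub>v n = (0\<^sub>v m :: real vec)"
  by (intro eq_vecI) (auto simp: scalar_prod_def)

lemma sum_mat_mv:
  "A \<in> carrier_mat n m \<Longrightarrow> B \<in> carrier_mat n m \<Longrightarrow> dim_vec v = m \<Longrightarrow> (A + B) *\<^sub>v v = A *\<^sub>v v + B *\<^sub>v (v :: real vec)"
  by (rule add_mult_distrib_mat_vec[of _ n m]) (auto intro: carrier_vecI)

lemma shift_mv:
  assumes "A \<in> carrier_mat n n" "v \<in> carrier_vec n"
  shows "(A + l \<cdot>\<^sub>m 1\<^sub>m n) *\<^sub>v v = A *\<^sub>v v + l \<cdot>\<^sub>v (v :: real vec)"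
proof -
  have "(l \<cdot>\<^sub>m 1\<^sub>m n) *\<^sub>v v = l \<cdot>\<^sub>v v"
    using assms by (intro eq_vecI) (auto simp: row_smult)
  thus ?thesis using assms by (subst sum_mat_mv[of _ n n]) auto
qed

lemma shift_sym:
  assumes "A \<in> carrier_mat n n" "transpose_mat A = A"
  shows "transpose_mat (A + l \<cdot>\<^sub>m 1\<^sub>m n) = A + (l :: real) \<cdot>\<^sub>m 1\<^sub>m n"
proof -
  have "transpose_mat (l \<cdot>\<^sub>m 1\<^sub>m n) = (l \<cdot>\<^sub>m 1\<^sub>m n :: real mat)"
    by (intro eq_matI) auto
  thus ?thesis using assms by (subst transpose_add[of _ n n]) auto
qed

lemmas vec_bilin = sp_add_left sp_add_right sp_diff_left sp_diff_right sp_smult_left sp_smult_right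
  mv_add mv_diff mv_smult mv_uminus

lemma sp_self_nonneg [simp]: "(v :: real vec) \<bullet> v \<ge> 0"
  by (auto simp: scalar_prod_def intro!: sum_nonneg)

lemma sp_self_eq_0: "v \<in> carrier_vec n \<Longrightarrow> (v :: real vec) \<bullet> v = 0 \<longleftrightarrow> v = 0\<^sub>v n"
proof
  assume v: "v \<in> carrier_vec n" and "v \<bullet> v = 0"
  hence "\<forall>i\<in>{0..<n}. v $ i * v $ i = 0"
    unfolding scalar_prod_def by (subst (asm) sum_nonneg_eq_0_iff) auto
  thus "v = 0\<^sub>v n" using v by (intro eq_vecI) auto
qed auto

lemma sp_self_pos: "v \<in> carrier_vec n \<Longrightarrow> v \<noteq> 0\<^sub>v n \<Longrightarrow> (v :: real vec) \<bullet> v > 0"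
  using sp_self_nonneg[of v] sp_self_eq_0[of v n] by linarith

lemma vnorm_nonneg [simp]: "vnorm v \<ge> 0"
  by (simp add: vnorm_def)

lemma vnorm_sq: "vnorm v ^ 2 = v \<bullet> v"
  by (simp add: vnorm_def)

lemma vnorm_pos: "v \<in> carrier_vec n \<Longrightarrow> v \<noteq> 0\<^sub>v n \<Longrightarrow> vnorm v > 0"
  by (simp add: vnorm_def sp_self_pos)

lemma vnorm_smult: "vnorm (c \<cdot>\<^sub>v v) = \<bar>c\<bar> * vnorm v"
  unfolding vnorm_def by (simp add: real_sqrt_mult mult.assoc[symmetric])

lemma sym_mat_sp:
  assumes "S \<in> carrier_mat n n" "transpose_mat S = S" "u \<in> carrier_vec n" "v \<in> carrier_vec n"
  shows "(S *\<^sub>v u) \<bullet> v = u \<bullet> (S *\<^sub>v (v :: real vec))"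
  using transpose_vec_mult_scalar[OF assms(1,4,3)] assms(2) by simp

lemma quadratic_nonneg_discriminant:
  fixes a b c :: real
  assumes "\<And>t. a + 2 * t * b + t\<^sup>2 * c \<ge> 0"
    and c0: "c \<ge> 0"
  shows "b\<^sup>2 \<le> a * c"
proof (cases "c = 0")
  case True
  have "b = 0"
  proof (rule ccontr)
    assume "b \<noteq> 0"
    \<comment> \<open>With \<open>c = 0\<close> the expression is affine in \<open>t\<close>; this
      \<open>t\<close> would give it the value -1.\<close>
    hence "2 * (- (a + 1) / (2 * b)) * b = - (a + 1)" by simp
    thus False using assms(1)[of "- (a + 1) / (2 * b)"] True by simp
  qed
  thus ?thesis using True by simp
next
  case False
  hence c: "c > 0" using c0 by simp
  have "0 \<le> (a + 2 * (- b / c) * b + (- b / c)\<^sup>2 * c) * c"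
    using assms(1)[of "- b / c"] c by simp
  also have "\<dots> = a * c - b\<^sup>2"
    using c by (simp add: field_simps power2_eq_square)
  finally show ?thesis by simp
qed

text \<open>The form of \<open>P\<close> along the line \<open>u + t v\<close> is a nonnegative
  quadratic in \<open>t\<close>. \<open>P\<close> may be singular: the case \<open>b = a\<close> of
  \<open>last_component_bound\<close> applies this to a vanishing form.\<close>

lemma psd_cauchy_schwarz:
  assumes P: "P \<in> carrier_mat n n" "transpose_mat P = P" "psd n P"
    and u: "u \<in> carrier_vec n" and v: "v \<in> carrier_vec n"
  shows "(u \<bullet> (P *\<^sub>v v))\<^sup>2 \<le> (u \<bullet> (P *\<^sub>v u)) * (v \<bullet> (P *\<^sub>v v))"
proof (rule quadratic_nonneg_discriminant)
  fix t :: real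
  note [simp] = carrier_vecD[OF u] carrier_vecD[OF v] carrier_matD[OF P(1)]
  have "v \<bullet> (P *\<^sub>v u) = u \<bullet> (P *\<^sub>v v)"
    using sym_mat_sp[OF P(1,2) u v] sp_comm[of v "P *\<^sub>v u"] by simp
  moreover have "(u + t \<cdot>\<^sub>v v) \<bullet> (P *\<^sub>v (u + t \<cdot>\<^sub>v v)) \<ge> 0"
    using P(3) u v unfolding psd_def by simp
  ultimately show "u \<bullet> (P *\<^sub>v u) + 2 * t * (u \<bullet> (P *\<^sub>v v)) + t\<^sup>2 * (v \<bullet> (P *\<^sub>v v)) \<ge> 0"
    by (simp add: vec_bilin power2_eq_square algebra_simps)
qed (use P(3) v in \<open>simp add: psd_def\<close>)

lemma cauchy_schwarz_sq:
  assumes u: "u \<in> carrier_vec n" and v: "(v :: real vec) \<in> carrier_vec n"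
  shows "(u \<bullet> v)\<^sup>2 \<le> (u \<bullet> u) * (v \<bullet> v)"
  using psd_cauchy_schwarz[of "1\<^sub>m n" n u v] assms by (simp add: psd_def)

lemma cauchy_schwarz:
  assumes u: "u \<in> carrier_vec n" and v: "v \<in> carrier_vec n"
  shows "\<bar>u \<bullet> v\<bar> \<le> vnorm u * vnorm v"
  using cauchy_schwarz_sq[OF assms] unfolding vnorm_def real_sqrt_mult[symmetric]
  by (metis real_sqrt_abs real_sqrt_le_mono)

section \<open>Extremal eigenvalues\<close>

lemma mult_mat_vec_bounded:
  assumes M: "M \<in> carrier_mat n n"
  obtains K where "K > 0" "\<And>v. v \<in> carrier_vec n \<Longrightarrow> (M *\<^sub>v v) \<bullet> (M *\<^sub>v v) \<le> K * (v \<bullet> (v :: real vec))"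
proof
  \<comment> \<open>The squared Frobenius norm, raised by 1 so that \<open>K\<close> is positive
    even for the zero matrix.\<close>
  define K where "K = (\<Sum>i<n. row M i \<bullet> row M i) + 1"
  show "K > 0" unfolding K_def by (intro add_nonneg_pos sum_nonneg) auto
  fix v :: "real vec" assume v: "v \<in> carrier_vec n"
  have "(M *\<^sub>v v) \<bullet> (M *\<^sub>v v) = (\<Sum>i<n. (row M i \<bullet> v)\<^sup>2)"
    using M v by (auto simp: scalar_prod_def[of "M *\<^sub>v v"] power2_eq_square lessThan_atLeast0)
  also have "\<dots> \<le> (\<Sum>i<n. (row M i \<bullet> row M i) * (v \<bullet> v))"
    using M v by (intro sum_mono cauchy_schwarz_sq[of _ n]) auto
  also have "\<dots> \<le> K * (v \<bullet> v)"
    unfolding K_def distrib_right sum_distrib_right by simp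
  finally show "(M *\<^sub>v v) \<bullet> (M *\<^sub>v v) \<le> K * (v \<bullet> v)" .
qed

text \<open>For \<open>w = P v\<close>, Cauchy-Schwarz in the form of \<open>P\<close> gives
  \<open>(w \<bullet> w)^2 \<le> (v \<bullet> P v) (w \<bullet> P w)\<close>. Boundedness of
  \<open>P\<close> controls the last factor by \<open>w \<bullet> w\<close>, so
  \<open>v \<bullet> P v\<close> dominates \<open>w \<bullet> w\<close>, and boundedness of the
  inverse \<open>R\<close> returns from \<open>w\<close> to \<open>v\<close>.\<close>

lemma psd_nonsingular_bounded_below:
  assumes P: "P \<in> carrier_mat n n" "transpose_mat P = P" "psd n P" and det: "det P \<noteq> 0"
  obtains \<epsilon> where "\<epsilon> > 0" "\<And>v. v \<in> carrier_vec n \<Longrightarrow> \<epsilon> * (v \<bullet> v) \<le> v \<bullet> (P *\<^sub>v v)"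
proof -
  note [simp] = carrier_matD[OF P(1)]
  from det_non_zero_imp_unit[OF P(1) det, unfolded Units_def, of "()"]
  obtain R where R: "R \<in> carrier_mat n n" and RP: "R * P = 1\<^sub>m n"
    by (auto simp: ring_mat_def)
  obtain K where K: "K > 0" "\<And>v. v \<in> carrier_vec n \<Longrightarrow> (P *\<^sub>v v) \<bullet> (P *\<^sub>v v) \<le> K * (v \<bullet> v)"
    using mult_mat_vec_bounded[OF P(1)] by blast
  obtain L where L: "L > 0" "\<And>v. v \<in> carrier_vec n \<Longrightarrow> (R *\<^sub>v v) \<bullet> (R *\<^sub>v v) \<le> L * (v \<bullet> v)"
    using mult_mat_vec_bounded[OF R] by blast
  have main: "v \<bullet> v \<le> (L * (1 + K)) * (v \<bullet> (P *\<^sub>v v))" if v: "v \<in> carrier_vec n" for v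
  proof -
    define w where "w = P *\<^sub>v v"
    have w: "w \<in> carrier_vec n" using P v by (simp add: w_def)
    have Pw: "P *\<^sub>v w \<in> carrier_vec n" using P w by simp
    note [simp] = carrier_vecD[OF v] carrier_vecD[OF w]
    have q0: "v \<bullet> w \<ge> 0" using P(3) v by (auto simp: psd_def w_def)
    have "0 \<le> (w - P *\<^sub>v w) \<bullet> (w - P *\<^sub>v w)" by simp
    also have "\<dots> = w \<bullet> w - 2 * (w \<bullet> (P *\<^sub>v w)) + (P *\<^sub>v w) \<bullet> (P *\<^sub>v w)"
      using sp_comm[of w "P *\<^sub>v w"] by (simp add: vec_bilin)
    finally have "2 * (w \<bullet> (P *\<^sub>v w)) \<le> (1 + K) * (w \<bullet> w)"
      using K(2)[OF w] by (simp add: algebra_simps)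
    hence wPw: "w \<bullet> (P *\<^sub>v w) \<le> (1 + K) * (w \<bullet> w)"
      using K(1) mult_nonneg_nonneg[of "1 + K" "w \<bullet> w"] sp_self_nonneg[of w] by linarith
    have "(w \<bullet> w)\<^sup>2 = (v \<bullet> (P *\<^sub>v w))\<^sup>2"
      using sym_mat_sp[OF P(1,2) v w] by (simp add: w_def)
    also have "\<dots> \<le> (v \<bullet> w) * (w \<bullet> (P *\<^sub>v w))"
      using psd_cauchy_schwarz[OF P v w] by (simp add: w_def)
    also have "\<dots> \<le> (v \<bullet> w) * ((1 + K) * (w \<bullet> w))"
      using wPw q0 by (intro mult_left_mono)
    finally have *: "(w \<bullet> w) * (w \<bullet> w) \<le> ((1 + K) * (v \<bullet> w)) * (w \<bullet> w)"
      by (simp add: power2_eq_square algebra_simps)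
    have ww: "w \<bullet> w \<le> (1 + K) * (v \<bullet> w)"
    proof (cases "w \<bullet> w = 0")
      case True thus ?thesis using q0 K(1) by simp
    next
      case False
      hence "w \<bullet> w > 0" using sp_self_nonneg[of w] by linarith
      thus ?thesis using * by (simp add: mult_le_cancel_right)
    qed
    have "v = R *\<^sub>v w"
      using RP R P v by (simp add: w_def flip: assoc_mult_mat_vec[of _ n n _ n])
    hence "v \<bullet> v \<le> L * (w \<bullet> w)" using L(2)[OF w] by simp
    also have "\<dots> \<le> L * ((1 + K) * (v \<bullet> w))" using ww L(1) by simp
    finally show ?thesis by (simp add: w_def algebra_simps)
  qed
  show ?thesis
  proof
    show pos: "1 / (L * (1 + K)) > 0" using K L by simp
    fix v :: "real vec" assume v: "v \<in> carrier_vec n"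
    show "1 / (L * (1 + K)) * (v \<bullet> v) \<le> v \<bullet> (P *\<^sub>v v)"
      using main[OF v] K(1) L(1) by (simp add: divide_le_eq mult.commute)
  qed
qed

text \<open>Take \<open>\<mu>\<close> as the supremum of all lower bounds of the Rayleigh quotient.
  Then \<open>A - \<mu> I\<close> is positive semidefinite. Were it nonsingular, it would be bounded
  below by some \<epsilon> > 0 and \<open>\<mu>\<close> could be increased; hence it has a kernel
  vector, which is an eigenvector of \<open>A\<close>.\<close>

lemma least_eigenvalue_exists:
  fixes A :: "real mat"
  assumes A: "A \<in> carrier_mat n n" "transpose_mat A = A" and n: "n > 0"
  obtains \<mu> where "eigenvalue A \<mu>" "\<And>v. v \<in> carrier_vec n \<Longrightarrow> \<mu> * (v \<bullet> v) \<le> v \<bullet> (A *\<^sub>v v)"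
proof -
  note [simp] = carrier_matD[OF A(1)]
  define X where "X = {m. \<forall>v\<in>carrier_vec n. m * (v \<bullet> v) \<le> v \<bullet> (A *\<^sub>v v)}"
  obtain K where K: "K > 0" "\<And>v. v \<in> carrier_vec n \<Longrightarrow> (A *\<^sub>v v) \<bullet> (A *\<^sub>v v) \<le> K * (v \<bullet> v)"
    using mult_mat_vec_bounded[OF A(1)] by blast
  \<comment> \<open>Expanding \<open>0 \<le> (v + A v) \<bullet> (v + A v)\<close> bounds
    \<open>v \<bullet> A v\<close> from below.\<close>
  have "- (1 + K) / 2 \<in> X"
    unfolding X_def
  proof clarify
    fix v :: "real vec" assume v: "v \<in> carrier_vec n"
    note [simp] = carrier_vecD[OF v]
    have "0 \<le> (v + A *\<^sub>v v) \<bullet> (v + A *\<^sub>v v)" by simp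
    also have "\<dots> = v \<bullet> v + 2 * (v \<bullet> (A *\<^sub>v v)) + (A *\<^sub>v v) \<bullet> (A *\<^sub>v v)"
      using sp_comm[of v "A *\<^sub>v v"] by (simp add: vec_bilin)
    finally show "- (1 + K) / 2 * (v \<bullet> v) \<le> v \<bullet> (A *\<^sub>v v)"
      using K(2)[OF v] by (simp add: field_simps)
  qed
  hence Xne: "X \<noteq> {}" by blast
  have ub: "m \<le> (v \<bullet> (A *\<^sub>v v)) / (v \<bullet> v)" if "m \<in> X" "v \<in> carrier_vec n" "v \<noteq> 0\<^sub>v n" for m v
    using that sp_self_pos[of v n] by (auto simp: X_def pos_le_divide_eq)
  have u: "unit_vec n 0 \<noteq> (0\<^sub>v n :: real vec)"
  proof
    assume "unit_vec n 0 = (0\<^sub>v n :: real vec)"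
    hence "unit_vec n 0 $ 0 = (0\<^sub>v n :: real vec) $ 0" by (rule arg_cong)
    thus False using n by simp
  qed
  have bdd: "bdd_above X"
    by (rule bdd_aboveI, rule ub[OF _ _ u]) auto
  define \<mu> where "\<mu> = Sup X"
  have \<mu>: "\<mu> * (v \<bullet> v) \<le> v \<bullet> (A *\<^sub>v v)" if v: "v \<in> carrier_vec n" for v
  proof (cases "v = 0\<^sub>v n")
    case True thus ?thesis using A by simp
  next
    case False
    have "\<mu> \<le> (v \<bullet> (A *\<^sub>v v)) / (v \<bullet> v)"
      unfolding \<mu>_def using Xne ub[OF _ v False] by (rule cSup_least)
    thus ?thesis using sp_self_pos[OF v False] by (simp add: pos_le_divide_eq)
  qed
  define P where "P = A + (- \<mu>) \<cdot>\<^sub>m 1\<^sub>m n"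
  have P: "P \<in> carrier_mat n n" using A by (simp add: P_def)
  have Pt: "transpose_mat P = P"
    unfolding P_def using A by (rule shift_sym)
  have Pv: "P *\<^sub>v v = A *\<^sub>v v + (- \<mu>) \<cdot>\<^sub>v v" if "v \<in> carrier_vec n" for v
    unfolding P_def using shift_mv[OF A(1) that] .
  have Pq: "v \<bullet> (P *\<^sub>v v) = v \<bullet> (A *\<^sub>v v) - \<mu> * (v \<bullet> v)" if "v \<in> carrier_vec n" for v
    using that by (simp add: Pv vec_bilin)
  have psd: "psd n P" using \<mu> by (simp add: psd_def Pq)
  have "det P = 0"
  proof (rule ccontr)
    assume "det P \<noteq> 0"
    from psd_nonsingular_bounded_below[OF P Pt psd this] obtain \<epsilon> where
      \<epsilon>: "\<epsilon> > 0" "\<And>v. v \<in> carrier_vec n \<Longrightarrow> \<epsilon> * (v \<bullet> v) \<le> v \<bullet> (P *\<^sub>v v)" by blast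
    have "\<mu> + \<epsilon> \<in> X" using \<epsilon>(2) Pq by (auto simp: X_def algebra_simps)
    hence "\<mu> + \<epsilon> \<le> \<mu>" unfolding \<mu>_def using bdd by (intro cSup_upper)
    thus False using \<epsilon>(1) by simp
  qed
  then obtain v where v: "v \<in> carrier_vec n" "v \<noteq> 0\<^sub>v n" "P *\<^sub>v v = 0\<^sub>v n"
    using det_0_iff_vec_prod_zero[OF P] by blast
  have "A *\<^sub>v v = \<mu> \<cdot>\<^sub>v v"
  proof (rule eq_vecI)
    fix i assume "i < dim_vec (\<mu> \<cdot>\<^sub>v v)"
    hence i: "i < n" using v by simp
    have "(A *\<^sub>v v + (- \<mu>) \<cdot>\<^sub>v v) $ i = 0\<^sub>v n $ i" using v(3) Pv[OF v(1)] by simp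
    thus "(A *\<^sub>v v) $ i = (\<mu> \<cdot>\<^sub>v v) $ i" using i v(1)
      by (simp del: index_mult_mat_vec)
  qed (use v in simp)
  hence "eigenvalue A \<mu>" unfolding eigenvalue_def eigenvector_def using v by auto
  thus ?thesis using that \<mu> by blast
qed

text \<open>The lower bound holds with some eigenvalue, hence with the smallest one; the upper bound
  is the same statement for \<open>- A\<close>.\<close>

lemma rayleigh_bounds:
  fixes A :: "real mat"
  assumes A: "A \<in> carrier_mat n n" "transpose_mat A = A" and v: "v \<in> carrier_vec n"
    and n: "n > 0"
  shows "Min {a. eigenvalue A a} * (v \<bullet> v) \<le> v \<bullet> (A *\<^sub>v v)"
    and "v \<bullet> (A *\<^sub>v v) \<le> Max {a. eigenvalue A a} * (v \<bullet> v)"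
proof -
  have fin: "finite {a. eigenvalue A a}"
    using card_finite_spectrum(1)[OF A(1)] by (simp add: spectrum_def)
  obtain \<mu> where \<mu>: "eigenvalue A \<mu>" "\<mu> * (v \<bullet> v) \<le> v \<bullet> (A *\<^sub>v v)"
    using least_eigenvalue_exists[OF A n] v by blast
  have "Min {a. eigenvalue A a} * (v \<bullet> v) \<le> \<mu> * (v \<bullet> v)"
    using fin \<mu>(1) by (intro mult_right_mono Min_le) auto
  thus "Min {a. eigenvalue A a} * (v \<bullet> v) \<le> v \<bullet> (A *\<^sub>v v)" using \<mu>(2) by linarith
  have mA: "- A \<in> carrier_mat n n" "transpose_mat (- A) = - A"
    using A by (auto simp: transpose_uminus)
  obtain \<nu> where \<nu>: "eigenvalue (- A) \<nu>" "\<nu> * (v \<bullet> v) \<le> v \<bullet> (- A *\<^sub>v v)"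
    using least_eigenvalue_exists[OF mA n] v by blast
  have "eigenvalue A (- \<nu>)"
  proof -
    obtain w where w: "w \<in> carrier_vec n" "w \<noteq> 0\<^sub>v n" "- A *\<^sub>v w = \<nu> \<cdot>\<^sub>v w"
      using \<nu>(1) A(1) unfolding eigenvalue_def eigenvector_def by auto
    have "- (A *\<^sub>v w) = \<nu> \<cdot>\<^sub>v w" using w A(1) by simp
    hence "- (- (A *\<^sub>v w)) = - (\<nu> \<cdot>\<^sub>v w)" by simp
    hence "A *\<^sub>v w = (- \<nu>) \<cdot>\<^sub>v w" by auto
    thus ?thesis using w A(1) unfolding eigenvalue_def eigenvector_def by auto
  qed
  hence "- \<nu> * (v \<bullet> v) \<le> Max {a. eigenvalue A a} * (v \<bullet> v)"
    using fin by (intro mult_right_mono Max_ge) auto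
  moreover have "v \<bullet> (- A *\<^sub>v v) = - (v \<bullet> (A *\<^sub>v v))"
    using A(1) v by simp
  ultimately show "v \<bullet> (A *\<^sub>v v) \<le> Max {a. eigenvalue A a} * (v \<bullet> v)"
    using \<nu>(2) by linarith
qed

section \<open>Coercive symmetric matrices\<close>

lemma index_mv_sum:
  "C \<in> carrier_mat m n \<Longrightarrow> v \<in> carrier_vec n \<Longrightarrow> i < m \<Longrightarrow> (C *\<^sub>v v) $ i = (\<Sum>l<n. C $$ (i, l) * (v $ l :: real))"
  by (auto simp: scalar_prod_def lessThan_atLeast0)

lemma abs_index_le_vnorm:
  assumes "v \<in> carrier_vec n" "i < n"
  shows "\<bar>v $ i\<bar> \<le> vnorm v"
proof -
  have "unit_vec n i \<bullet> unit_vec n i = (1 :: real)" using assms(2) by simp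
  thus ?thesis
    using cauchy_schwarz[of "unit_vec n i" n v] assms by (simp add: vnorm_def)
qed

text \<open>The constant \<open>a\<close> stays explicit because the full matrix and its compression
  to the Krylov space share it, and it is the denominator of the condition number.\<close>

locale coercive_sym_mat =
  fixes n :: nat and C :: "real mat" and a :: real
  assumes carrier: "C \<in> carrier_mat n n"
    and sym: "transpose_mat C = C"
    and pos: "a > 0"
    and lower: "v \<in> carrier_vec n \<Longrightarrow> a * (v \<bullet> v) \<le> v \<bullet> (C *\<^sub>v v)"
begin

lemma dims [simp]: "dim_row C = n" "dim_col C = n"
  using carrier by auto

lemma eq_0_if_form_le_0:
  assumes "v \<in> carrier_vec n" "v \<bullet> (C *\<^sub>v v) \<le> 0"
  shows "v = 0\<^sub>v n"
proof (rule ccontr)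
  assume "v \<noteq> 0\<^sub>v n"
  hence "a * (v \<bullet> v) > 0" using sp_self_pos[OF assms(1)] pos by simp
  thus False using lower[OF assms(1)] assms(2) by linarith
qed

lemma form_pos: "v \<in> carrier_vec n \<Longrightarrow> v \<noteq> 0\<^sub>v n \<Longrightarrow> v \<bullet> (C *\<^sub>v v) > 0"
  using eq_0_if_form_le_0[of v] by linarith

lemma minv_inverse: "minv C \<in> carrier_mat n n" "C * minv C = 1\<^sub>m n" "minv C * C = 1\<^sub>m n"
proof -
  \<comment> \<open>Coercivity excludes kernel vectors, so \<open>mat_inverse\<close> returns a
    \<open>Some\<close> and the \<open>the\<close> in \<open>minv\<close> picks the true
    inverse.\<close>
  have "det C \<noteq> 0"
  proof
    assume "det C = 0"
    then obtain v where "v \<in> carrier_vec n" "v \<noteq> 0\<^sub>v n" "C *\<^sub>v v = 0\<^sub>v n"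
      using det_0_iff_vec_prod_zero[OF carrier] by blast
    thus False using eq_0_if_form_le_0[of v] by simp
  qed
  hence "C \<in> Units (ring_mat TYPE(real) n ())"
    by (rule det_non_zero_imp_unit[OF carrier])
  then obtain R where R: "mat_inverse C = Some R"
    using mat_inverse(1)[OF carrier, of "()"] by (cases "mat_inverse C") auto
  show "minv C \<in> carrier_mat n n" "C * minv C = 1\<^sub>m n" "minv C * C = 1\<^sub>m n"
    using mat_inverse(2)[OF carrier R] R by (auto simp: minv_def)
qed

lemma minv_dims [simp]: "dim_row (minv C) = n" "dim_col (minv C) = n"
  using minv_inverse(1) by auto

lemma minv_carrier_vec [simp]: "minv C *\<^sub>v v \<in> carrier_vec n"
  by (rule carrier_vecI) simp

lemma mult_carrier_vec [simp]: "C *\<^sub>v v \<in> carrier_vec n"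
  by (rule carrier_vecI) simp

lemma mult_minv [simp]: "v \<in> carrier_vec n \<Longrightarrow> C *\<^sub>v (minv C *\<^sub>v v) = v"
  using minv_inverse carrier by (simp flip: assoc_mult_mat_vec[of _ n n _ n])

lemma minv_mult [simp]: "v \<in> carrier_vec n \<Longrightarrow> minv C *\<^sub>v (C *\<^sub>v v) = v"
  using minv_inverse carrier by (simp flip: assoc_mult_mat_vec[of _ n n _ n])

lemmas mult_sp = sym_mat_sp[OF carrier sym]

lemma minv_sp:
  assumes "u \<in> carrier_vec n" "v \<in> carrier_vec n"
  shows "(minv C *\<^sub>v u) \<bullet> v = u \<bullet> (minv C *\<^sub>v v)"
  using mult_sp[of "minv C *\<^sub>v u" "minv C *\<^sub>v v"] assms by simp

lemma minv_form_pos: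
  assumes v: "v \<in> carrier_vec n" and nz: "v \<noteq> 0\<^sub>v n"
  shows "v \<bullet> (minv C *\<^sub>v v) > 0"
proof -
  have "minv C *\<^sub>v v \<noteq> 0\<^sub>v n"
  proof
    assume "minv C *\<^sub>v v = 0\<^sub>v n"
    hence "C *\<^sub>v (minv C *\<^sub>v v) = C *\<^sub>v 0\<^sub>v n" by simp
    also have "C *\<^sub>v 0\<^sub>v n = 0\<^sub>v n" by (rule mv_zero[OF carrier])
    finally show False using v nz by simp
  qed
  thus ?thesis using form_pos[of "minv C *\<^sub>v v"] v minv_sp[OF v v] by simp
qed

lemma minv_form_nonneg: "v \<in> carrier_vec n \<Longrightarrow> v \<bullet> (minv C *\<^sub>v v) \<ge> 0"
  using minv_form_pos[of v] minv_inverse(1) by (cases "v = 0\<^sub>v n") auto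

text \<open>A division-free form of the convexity of \<open>\<lambda> \<mapsto> \<parallel>(C + \<lambda> I)\<^sup>-\<^sup>1 b\<parallel>\<^sup>2\<close>,
  comparing the values at \<open>\<lambda> = 0\<close> and \<open>\<lambda> = - \<delta>\<close>.\<close>

lemma norm_sq_shift_lower:
  assumes h: "h \<in> carrier_vec n" and u: "u \<in> carrier_vec n" and \<delta>: "\<delta> \<ge> 0"
    and eq: "C *\<^sub>v h - \<delta> \<cdot>\<^sub>v h = C *\<^sub>v u"
    and shift: "\<And>w. w \<in> carrier_vec n \<Longrightarrow> \<delta> * (w \<bullet> w) \<le> w \<bullet> (C *\<^sub>v w)"
  shows "2 * \<delta> * (u \<bullet> (minv C *\<^sub>v u)) \<le> h \<bullet> h - u \<bullet> u"
proof -
  note [simp] = carrier_vecD[OF h] carrier_vecD[OF u]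
  define d where "d = h - u"
  define t where "t = minv C *\<^sub>v u"
  define w where "w = minv C *\<^sub>v d"
  have [simp]: "dim_vec d = n" "dim_vec t = n" "dim_vec w = n"
    by (simp_all add: d_def t_def w_def)
  have cs: "d \<in> carrier_vec n" "t \<in> carrier_vec n" "w \<in> carrier_vec n"
    by (simp_all add: carrier_vecI)
  have Ct: "C *\<^sub>v t = u" and Cw: "C *\<^sub>v w = d" using u cs by (simp_all add: t_def w_def)
  have "C *\<^sub>v d = C *\<^sub>v h - C *\<^sub>v u" by (simp add: d_def mv_diff)
  also have "\<dots> = \<delta> \<cdot>\<^sub>v h"
    unfolding eq[symmetric] by (intro eq_vecI) (simp_all del: index_mult_mat_vec)
  finally have "d = \<delta> \<cdot>\<^sub>v (minv C *\<^sub>v h)"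
    using cs minv_mult[of d] by (simp add: mv_smult)
  also have "h = u + d" by (intro eq_vecI) (simp_all add: d_def)
  finally have d: "d = \<delta> \<cdot>\<^sub>v (t + w)" by (simp add: mv_add t_def w_def)
  have ud: "u \<bullet> d = \<delta> * (u \<bullet> t) + \<delta> * (t \<bullet> d)"
    using mult_sp[of t w] cs by (subst d) (simp add: Ct Cw vec_bilin distrib_left)
  have dd: "d \<bullet> d = \<delta> * (t \<bullet> d) + \<delta> * (w \<bullet> d)"
    by (subst d) (simp add: vec_bilin distrib_left)
  have hu: "h \<bullet> h = u \<bullet> u + 2 * (u \<bullet> d) + d \<bullet> d"
    using sp_comm[of u h] by (simp add: d_def vec_bilin)
  \<comment> \<open>By \<open>ud\<close>, \<open>dd\<close> and \<open>hu\<close> it remains to show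
    \<open>\<delta> (t \<bullet> d) \<ge> 0\<close>. Now \<open>p = \<delta> t\<close>, but also
    \<open>p = (C - \<delta> I) w\<close>, so \<open>shift\<close> gives
    \<open>p \<bullet> w \<ge> 0\<close>, and \<open>d = p + \<delta> w\<close> then gives
    \<open>p \<bullet> d \<ge> 0\<close>.\<close>
  define p where "p = d - \<delta> \<cdot>\<^sub>v w"
  have pw: "p \<bullet> w \<ge> 0"
    using shift[OF cs(3)] sp_comm[of w d] by (simp add: p_def Cw vec_bilin)
  have [simp]: "dim_vec p = n" by (simp add: p_def)
  have "d = p + \<delta> \<cdot>\<^sub>v w" by (intro eq_vecI) (simp_all add: p_def)
  hence "p \<bullet> d = p \<bullet> p + \<delta> * (p \<bullet> w)" by (simp add: vec_bilin)
  hence "p \<bullet> d \<ge> 0" using pw \<delta> by simp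
  hence "d \<bullet> d - \<delta> * (w \<bullet> d) \<ge> 0" by (simp add: p_def vec_bilin)
  thus ?thesis using ud dd hu sp_self_nonneg[of d] by (simp add: t_def)
qed

end

context coercive_sym_mat
begin

text \<open>The error \<open>e = z - x\<close> satisfies \<open>C e = r\<close>, so
  \<open>e \<bullet> x\<close> is the inner product of \<open>r\<close> with the inverse applied to
  \<open>x\<close>. Expanding the norm of \<open>z = x + e\<close> and dropping
  \<open>e \<bullet> e\<close> leaves the inequality.\<close>

lemma residual_norm_sq_diff:
  assumes x: "x \<in> carrier_vec n" and z: "z \<in> carrier_vec n"
  defines "r \<equiv> C *\<^sub>v z - C *\<^sub>v x"
  shows "x \<bullet> x - z \<bullet> z \<le> - 2 * (r \<bullet> (minv C *\<^sub>v x))"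
proof -
  note [simp] = carrier_vecD[OF x] carrier_vecD[OF z]
  define e where "e = z - x"
  have e: "e \<in> carrier_vec n" using x z by (simp add: e_def)
  have "r = C *\<^sub>v e" by (simp add: r_def e_def mv_diff)
  hence "r \<bullet> (minv C *\<^sub>v x) = e \<bullet> x" using x e mult_sp[OF e, of "minv C *\<^sub>v x"] by simp
  moreover have "e \<bullet> e = z \<bullet> z - 2 * (e \<bullet> x) - x \<bullet> x"
    using sp_comm[of x z] by (simp add: e_def vec_bilin)
  ultimately show ?thesis using sp_self_nonneg[of e] by linarith
qed

text \<open>The error \<open>e = z - x\<close> solves \<open>C e = \<eta> b\<close>, so
  \<open>C w\<close> is orthogonal to \<open>e\<close> because \<open>w\<close> is orthogonal to
  \<open>b\<close>. Thus \<open>z \<bullet> e = - \<omega> (b \<bullet> e)\<close>, which is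
  \<open>- \<omega> \<eta>\<close> times the inverse form at \<open>b\<close> and hence at most 0;
  so \<open>x = z - e\<close> is at least as long as \<open>z\<close>.\<close>

lemma galerkin_norm_sq_le:
  assumes x: "x \<in> carrier_vec n" and z: "z \<in> carrier_vec n"
    and w: "w \<in> carrier_vec n" and b: "b \<in> carrier_vec n"
    and res: "C *\<^sub>v z - C *\<^sub>v x = \<eta> \<cdot>\<^sub>v b"
    and wz: "C *\<^sub>v w = z + \<omega> \<cdot>\<^sub>v b" and orth: "b \<bullet> w = 0" and sgn: "\<omega> * \<eta> \<ge> 0"
  shows "z \<bullet> z \<le> x \<bullet> x"
proof -
  note [simp] = carrier_vecD[OF x] carrier_vecD[OF z] carrier_vecD[OF w] carrier_vecD[OF b]
  define e where "e = z - x"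
  have e: "e \<in> carrier_vec n" using x z by (simp add: e_def)
  note [simp] = carrier_vecD[OF e]
  have Ce: "C *\<^sub>v e = \<eta> \<cdot>\<^sub>v b" using res by (simp add: e_def mv_diff)
  hence eb: "e = \<eta> \<cdot>\<^sub>v (minv C *\<^sub>v b)" using minv_mult[OF e] by (simp add: mv_smult)
  have "(C *\<^sub>v w) \<bullet> e = 0"
    using mult_sp[OF w e] orth sp_comm[of b w] by (simp add: Ce vec_bilin)
  hence "z \<bullet> e = - \<omega> * (b \<bullet> e)" by (simp add: wz vec_bilin)
  also have "b \<bullet> e = \<eta> * (b \<bullet> (minv C *\<^sub>v b))" by (simp add: eb vec_bilin)
  finally have "z \<bullet> e = - ((\<omega> * \<eta>) * (b \<bullet> (minv C *\<^sub>v b)))" by simp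
  hence "z \<bullet> e \<le> 0" using mult_nonneg_nonneg[OF sgn minv_form_nonneg[OF b]] by linarith
  moreover have "x \<bullet> x = z \<bullet> z - 2 * (z \<bullet> e) + e \<bullet> e"
    using sp_comm[of x z] by (simp add: e_def vec_bilin)
  ultimately show ?thesis using sp_self_nonneg[of e] by linarith
qed

end

text \<open>Zeros above the superdiagonal follow from symmetry.\<close>

locale tridiagonal_coercive_mat = coercive_sym_mat +
  assumes tri: "i < n \<Longrightarrow> j + 1 < i \<Longrightarrow> C $$ (i, j) = 0"
begin

text \<open>The inverse of a tridiagonal matrix is semiseparable:
  \<open>G\<^sub>n\<^sub>j G\<^sub>1\<^sub>j = G\<^sub>1\<^sub>n G\<^sub>j\<^sub>j\<close>. The columns \<open>G e\<^sub>1\<close> and \<open>G e\<^sub>j\<close> solve the same homogeneous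
  recurrence below row \<open>j\<close>, so they are proportional there.\<close>

lemma minv_semiseparable:
  assumes j: "j < n"
  defines "u \<equiv> minv C *\<^sub>v unit_vec n 0" and "w \<equiv> minv C *\<^sub>v unit_vec n j"
  shows "w $ (n - 1) * u $ j = u $ (n - 1) * w $ j"
proof -
  have u: "u \<in> carrier_vec n" and w: "w \<in> carrier_vec n" by (simp_all add: u_def w_def)
  have Cu: "C *\<^sub>v u = unit_vec n 0" and Cw: "C *\<^sub>v w = unit_vec n j"
    by (simp_all add: u_def w_def)
  \<comment> \<open>This combination of the two columns vanishes at row \<open>j\<close>. A row
    \<open>i > j\<close> of \<open>C\<close> only meets columns from \<open>i - 1 \<ge> j\<close>
    on, so cutting off the rows above \<open>j\<close> does not disturb the recurrence there:
    \<open>C d\<close> vanishes below \<open>j\<close>, \<open>d\<close> vanishes up to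
    \<open>j\<close>, and the form at \<open>d\<close> is 0.\<close>
  define d where "d = vec n (\<lambda>i. if i \<ge> j then w $ i * u $ j - u $ i * w $ j else 0)"
  have d: "d \<in> carrier_vec n" by (simp add: d_def)
  have d0: "d $ i = 0" if "i \<le> j" for i using that j by (auto simp: d_def)
  have Cd: "(C *\<^sub>v d) $ i = 0" if i: "i < n" "j < i" for i
  proof -
    have "(C *\<^sub>v d) $ i = (\<Sum>l<n. C $$ (i, l) * d $ l)"
      by (rule index_mv_sum[OF carrier d i(1)])
    also have "\<dots> = (\<Sum>l<n. u $ j * (C $$ (i, l) * w $ l) - w $ j * (C $$ (i, l) * u $ l))"
    proof (intro sum.cong refl)
      fix l assume "l \<in> {..<n}"
      show "C $$ (i, l) * d $ l = u $ j * (C $$ (i, l) * w $ l) - w $ j * (C $$ (i, l) * u $ l)"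
      proof (cases "l \<ge> j")
        case True thus ?thesis using \<open>l \<in> {..<n}\<close> by (simp add: d_def algebra_simps)
      next
        case False
        hence "C $$ (i, l) = 0" using i by (intro tri) auto
        thus ?thesis by simp
      qed
    qed
    also have "\<dots> = u $ j * (C *\<^sub>v w) $ i - w $ j * (C *\<^sub>v u) $ i"
      by (simp only: index_mv_sum[OF carrier w i(1)] index_mv_sum[OF carrier u i(1)]
          sum_subtractf sum_distrib_left)
    also have "\<dots> = 0" unfolding Cu Cw using i j by simp
    finally show ?thesis .
  qed
  have "d \<bullet> (C *\<^sub>v d) = (\<Sum>i\<in>{0..<n}. d $ i * (C *\<^sub>v d) $ i)"
    by (simp add: scalar_prod_def)
  also have "\<dots> = 0"
  proof (intro sum.neutral ballI)
    fix i assume "i \<in> {0..<n}"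
    thus "d $ i * (C *\<^sub>v d) $ i = 0"
      using d0[of i] Cd[of i] by (cases "i \<le> j") (auto simp del: index_mult_mat_vec)
  qed
  finally have "d = 0\<^sub>v n" using eq_0_if_form_le_0[OF d] by simp
  hence "d $ (n - 1) = 0" using j by simp
  moreover have "j \<le> n - 1" using j by simp
  ultimately show ?thesis using j by (simp add: d_def)
qed

text \<open>With \<open>G\<close> the inverse, semiseparability turns the last entry of
  \<open>G u\<close> into \<open>u $ (n - 1)\<close> times the trace of \<open>G\<close>, and the
  diagonal of \<open>G\<close> is nonnegative.\<close>

lemma minv_corner_sign:
  assumes n: "n > 0"
  defines "u \<equiv> minv C *\<^sub>v unit_vec n 0"
  shows "(minv C *\<^sub>v u) $ (n - 1) * u $ (n - 1) \<ge> 0"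
proof -
  have u: "u \<in> carrier_vec n" by (simp add: u_def)
  let ?G = "\<lambda>i. minv C *\<^sub>v unit_vec n i"
  have G: "?G (n - 1) $ j = ?G j $ (n - 1)" if "j < n" for j
    using that minv_sp[of "unit_vec n j" "unit_vec n (n - 1)"]
    by (simp del: index_mult_mat_vec)
  have "(minv C *\<^sub>v u) $ (n - 1) = ?G (n - 1) \<bullet> u"
    using n u minv_sp[of "unit_vec n (n - 1)" u] by (simp del: index_mult_mat_vec)
  also have "\<dots> = (\<Sum>j<n. ?G (n - 1) $ j * u $ j)"
    using u by (simp add: scalar_prod_def lessThan_atLeast0 del: index_mult_mat_vec)
  also have "\<dots> = (\<Sum>j<n. u $ (n - 1) * ?G j $ j)"
    using minv_semiseparable G by (intro sum.cong) (auto simp: u_def simp del: index_mult_mat_vec)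
  also have "\<dots> = u $ (n - 1) * (\<Sum>j<n. ?G j $ j)"
    by (simp add: sum_distrib_left)
  finally have "(minv C *\<^sub>v u) $ (n - 1) * u $ (n - 1) = (u $ (n - 1))\<^sup>2 * (\<Sum>j<n. ?G j $ j)"
    by (simp add: power2_eq_square del: index_mult_mat_vec)
  moreover have "?G j $ j \<ge> 0" if "j < n" for j
    using that minv_form_nonneg[of "unit_vec n j"] by (simp del: index_mult_mat_vec)
  ultimately show ?thesis
    by (auto intro!: mult_nonneg_nonneg sum_nonneg simp del: index_mult_mat_vec)
qed

end

section \<open>Chebyshev bound\<close>

text \<open>Polarisation: with \<open>w = S v\<close>, the difference of the forms at
  \<open>v + t w\<close> and \<open>v - t w\<close> is \<open>4 t (w \<bullet> w)\<close>. Bounding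
  both forms by the squared norms yields a quadratic in \<open>t\<close> that is nonnegative
  everywhere; its discriminant gives the claim.\<close>

lemma sym_mat_contraction:
  fixes S :: "real mat"
  assumes S: "S \<in> carrier_mat n n" "transpose_mat S = S"
    and bound: "\<And>v. v \<in> carrier_vec n \<Longrightarrow> \<bar>v \<bullet> (S *\<^sub>v v)\<bar> \<le> v \<bullet> v"
    and v: "v \<in> carrier_vec n"
  shows "(S *\<^sub>v v) \<bullet> (S *\<^sub>v v) \<le> v \<bullet> v"
proof -
  define w where "w = S *\<^sub>v v"
  have w: "w \<in> carrier_vec n" using S v by (simp add: w_def)
  note [simp] = carrier_vecD[OF v] carrier_vecD[OF w] carrier_matD[OF S(1)]
  have vSw: "v \<bullet> (S *\<^sub>v w) = w \<bullet> w" using sym_mat_sp[OF S v w] by (simp add: w_def)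
  have wSv: "S *\<^sub>v v = w" by (simp add: w_def)
  have "(w \<bullet> w)\<^sup>2 \<le> (v \<bullet> v) * (w \<bullet> w)"
  proof (rule quadratic_nonneg_discriminant)
    fix t :: real
    have "(v - t \<cdot>\<^sub>v w) \<bullet> (S *\<^sub>v (v - t \<cdot>\<^sub>v w)) \<ge> - ((v - t \<cdot>\<^sub>v w) \<bullet> (v - t \<cdot>\<^sub>v w))"
      "(v + t \<cdot>\<^sub>v w) \<bullet> (S *\<^sub>v (v + t \<cdot>\<^sub>v w)) \<ge> - ((v + t \<cdot>\<^sub>v w) \<bullet> (v + t \<cdot>\<^sub>v w))"
      "(v - t \<cdot>\<^sub>v w) \<bullet> (S *\<^sub>v (v - t \<cdot>\<^sub>v w)) \<le> ((v - t \<cdot>\<^sub>v w) \<bullet> (v - t \<cdot>\<^sub>v w))"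
      "(v + t \<cdot>\<^sub>v w) \<bullet> (S *\<^sub>v (v + t \<cdot>\<^sub>v w)) \<le> ((v + t \<cdot>\<^sub>v w) \<bullet> (v + t \<cdot>\<^sub>v w))"
      using bound[of "v - t \<cdot>\<^sub>v w"] bound[of "v + t \<cdot>\<^sub>v w"] v w by (simp_all add: abs_le_iff)
    thus "v \<bullet> v + 2 * t * (w \<bullet> w) + t\<^sup>2 * (w \<bullet> w) \<ge> 0"
      by (simp add: vec_bilin vSw wSv power2_eq_square algebra_simps)
  qed simp
  thus ?thesis
    using sp_self_nonneg[of w] sp_self_nonneg[of v]
    by (cases "w \<bullet> w = 0") (auto simp: power2_eq_square w_def[symmetric])
qed

text \<open>The pair \<open>(T\<^sub>m(S) v, U\<^sub>m\<^sub>-\<^sub>1(S) v)\<close> of Chebyshev polynomials of both kinds. The Pell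
  identity \<open>T\<^sub>m\<^sup>2 + (1 - x\<^sup>2) U\<^sub>m\<^sub>-\<^sub>1\<^sup>2 = 1\<close> bounds \<open>\<parallel>T\<^sub>m(S) v\<parallel>\<close> for a symmetric contraction \<open>S\<close>
  without diagonalising it.\<close>

primrec cheb_pair :: "real mat \<Rightarrow> real vec \<Rightarrow> nat \<Rightarrow> real vec \<times> real vec" where
  "cheb_pair S v 0 = (v, 0\<^sub>v (dim_vec v))"
| "cheb_pair S v (Suc m) =
     (let (p, q) = cheb_pair S v m in (S *\<^sub>v p - (q - S *\<^sub>v (S *\<^sub>v q)), S *\<^sub>v q + p))"

lemma cheb_pair_carrier:
  assumes "S \<in> carrier_mat n n" "v \<in> carrier_vec n"
  shows "fst (cheb_pair S v m) \<in> carrier_vec n \<and> snd (cheb_pair S v m) \<in> carrier_vec n"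
proof (induction m)
  case (Suc m)
  thus ?case
    using carrier_matD[OF assms(1)] carrier_vecD[of "fst (cheb_pair S v m)" n]
    by (auto simp: case_prod_beta Let_def intro!: carrier_vecI)
qed (use assms in simp)

text \<open>The Pell identity applied to \<open>v\<close> and paired with \<open>v\<close>. Symmetry
  of \<open>S\<close> turns the term with \<open>1 - x^2\<close> into
  \<open>q \<bullet> q - (S q) \<bullet> (S q)\<close>, which is nonnegative when \<open>S\<close>
  is a contraction.\<close>

lemma cheb_pair_pell:
  assumes S: "S \<in> carrier_mat n n" "transpose_mat S = S" and v: "v \<in> carrier_vec n"
  shows "(case cheb_pair S v m of (p, q) \<Rightarrow> p \<bullet> p + q \<bullet> q - (S *\<^sub>v q) \<bullet> (S *\<^sub>v q)) = v \<bullet> v"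
proof (induction m)
  case 0
  have "S *\<^sub>v 0\<^sub>v n = 0\<^sub>v n" by (rule mv_zero[OF S(1)])
  thus ?case using v by auto
next
  case (Suc m)
  note [simp] = carrier_matD[OF S(1)]
  obtain p q where pq: "cheb_pair S v m = (p, q)" by force
  have p: "p \<in> carrier_vec n" and q: "q \<in> carrier_vec n"
    using cheb_pair_carrier[OF S(1) v, of m] by (simp_all add: pq)
  define w where "w = q - S *\<^sub>v (S *\<^sub>v q)"
  define r where "r = S *\<^sub>v q"
  define z where "z = S *\<^sub>v p"
  have w: "w \<in> carrier_vec n" and r: "r \<in> carrier_vec n" and z: "z \<in> carrier_vec n"
    using q p S by (simp_all add: w_def r_def z_def)
  note [simp] = carrier_vecD[OF p] carrier_vecD[OF q] carrier_vecD[OF w] carrier_vecD[OF r]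
    carrier_vecD[OF z]
  have Sr: "S *\<^sub>v r = q - w" by (intro eq_vecI) (simp_all add: w_def r_def del: index_mult_mat_vec)
  have qw: "q \<bullet> w = q \<bullet> q - r \<bullet> r"
    using sym_mat_sp[OF S q r] by (simp add: Sr r_def[symmetric] vec_bilin)
  have zr: "z \<bullet> r = p \<bullet> q - p \<bullet> w"
    using sym_mat_sp[OF S p r] by (simp add: Sr z_def[symmetric] vec_bilin)
  have zz: "z \<bullet> (q - w) = z \<bullet> q - z \<bullet> w" by (simp add: vec_bilin)
  have zq: "z \<bullet> q = p \<bullet> r" using sym_mat_sp[OF S p q] by (simp add: z_def r_def)
  have "(z - w) \<bullet> (z - w) + (r + p) \<bullet> (r + p) - (S *\<^sub>v (r + p)) \<bullet> (S *\<^sub>v (r + p))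
      = p \<bullet> p + q \<bullet> q - r \<bullet> r"
    using sp_comm[of z w] sp_comm[of r p] sp_comm[of q w] sp_comm[of z q] sp_comm[of z r] qw zr zq
    by (simp add: mv_add Sr z_def[symmetric] vec_bilin)
  thus ?case using Suc by (simp add: pq r_def z_def w_def)
qed

lemma cheb_pair_rec:
  assumes S: "S \<in> carrier_mat n n" and v: "v \<in> carrier_vec n"
  shows "fst (cheb_pair S v (Suc (Suc m)))
    = 2 \<cdot>\<^sub>v (S *\<^sub>v fst (cheb_pair S v (Suc m))) - fst (cheb_pair S v m)"
proof -
  note [simp] = carrier_matD[OF S(1)]
  obtain p q where pq: "cheb_pair S v m = (p, q)" by force
  have p: "p \<in> carrier_vec n" and q: "q \<in> carrier_vec n"
    using cheb_pair_carrier[OF S(1) v, of m] by (simp_all add: pq)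
  note [simp] = carrier_vecD[OF p] carrier_vecD[OF q]
  show ?thesis
    by (intro eq_vecI) (simp_all add: pq vec_bilin del: index_mult_mat_vec)
qed

text \<open>\<open>x\<close> is an eigenvector of \<open>S\<close> up to an error in row 0, and each
  application of a Hessenberg matrix pushes that error down by at most one row. From row
  \<open>m\<close> on, the Chebyshev polynomial of degree \<open>m\<close> in \<open>S\<close>
  therefore acts as its value \<open>\<tau> m\<close> at \<open>\<zeta>\<close>.\<close>

lemma cheb_pair_tail:
  assumes S: "S \<in> carrier_mat n n" and x: "x \<in> carrier_vec n"
    and hess: "\<And>i j. i < n \<Longrightarrow> j + 1 < i \<Longrightarrow> S $$ (i, j) = 0"
    and Sx: "S *\<^sub>v x = \<zeta> \<cdot>\<^sub>v x + c \<cdot>\<^sub>v unit_vec n 0"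
    and \<tau>: "\<tau> 0 = 1" "\<tau> (Suc 0) = \<zeta>" "\<And>m. \<tau> (Suc (Suc m)) = 2 * \<zeta> * \<tau> (Suc m) - \<tau> m"
    and i: "i < n" "m \<le> i"
  shows "fst (cheb_pair S x m) $ i = \<tau> m * x $ i"
  using i
proof (induction m arbitrary: i rule: less_induct)
  case (less m)
  note [simp] = carrier_matD[OF S] carrier_vecD[OF x]
  consider "m = 0" | "m = 1" | l where "m = Suc (Suc l)"
    by (metis One_nat_def not0_implies_Suc)
  thus ?case
  proof cases
    case 1
    thus ?thesis using \<tau> by simp
  next
    case 2
    have "S *\<^sub>v 0\<^sub>v n = 0\<^sub>v n" by (rule mv_zero[OF S])
    thus ?thesis using \<tau> less.prems 2 by (simp add: Sx del: index_mult_mat_vec)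
  next
    case 3
    define p where "p = fst (cheb_pair S x (Suc l))"
    have p: "p \<in> carrier_vec n" using cheb_pair_carrier[OF S x, of "Suc l"] unfolding p_def by (rule conjunct1)
    note [simp] = carrier_vecD[OF p]
    have "(S *\<^sub>v p) $ i = (\<Sum>j<n. S $$ (i, j) * p $ j)"
      using less.prems by (intro index_mv_sum[OF S p])
    also have "\<dots> = (\<Sum>j<n. \<tau> (Suc l) * (S $$ (i, j) * x $ j))"
    proof (intro sum.cong refl)
      fix j assume j: "j \<in> {..<n}"
      show "S $$ (i, j) * p $ j = \<tau> (Suc l) * (S $$ (i, j) * x $ j)"
      proof (cases "Suc l \<le> j")
        case True
        thus ?thesis using less.IH[of "Suc l" j] 3 j by (simp add: p_def)
      next
        case False
        hence "S $$ (i, j) = 0" using less.prems 3 by (intro hess) auto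
        thus ?thesis by simp
      qed
    qed
    also have "\<dots> = \<tau> (Suc l) * (S *\<^sub>v x) $ i"
      using less.prems by (simp only: index_mv_sum[OF S x] sum_distrib_left)
    also have "\<dots> = \<tau> (Suc l) * (\<zeta> * x $ i)"
      unfolding Sx using less.prems 3 by simp
    finally have Sp: "(S *\<^sub>v p) $ i = \<tau> (Suc l) * (\<zeta> * x $ i)" .
    have fl: "fst (cheb_pair S x l) \<in> carrier_vec n" using cheb_pair_carrier[OF S x] by simp
    have "fst (cheb_pair S x m) $ i = 2 * (S *\<^sub>v p) $ i - fst (cheb_pair S x l) $ i"
      unfolding 3 cheb_pair_rec[OF S x] p_def[symmetric]
      using less.prems fl by (simp del: index_mult_mat_vec)
    also have "fst (cheb_pair S x l) $ i = \<tau> l * x $ i"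
      using less.IH[of l i] less.prems 3 by simp
    finally show ?thesis unfolding Sp 3 \<tau>(3) by (simp add: algebra_simps)
  qed
qed

lemma half_sum_ratio_inverse:
  fixes p q :: real
  assumes "p > 0" "q > 0"
  shows "(p / q + inverse (p / q)) / 2 = (p\<^sup>2 + q\<^sup>2) / (2 * (p * q))"
  using assms by (simp add: field_simps power2_eq_square)

context tridiagonal_coercive_mat
begin

text \<open>The Chebyshev polynomial of degree \<open>n - 1\<close> in the rescaled matrix
  multiplies the last entry of \<open>x\<close> by its large value at \<open>\<zeta>\<close>, yet
  does not increase the norm of \<open>x\<close>.\<close>

lemma last_component_bound:
  assumes n: "n > 0" and upper: "\<And>v. v \<in> carrier_vec n \<Longrightarrow> v \<bullet> (C *\<^sub>v v) \<le> b * (v \<bullet> v)"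
    and x: "x \<in> carrier_vec n" and Cx: "C *\<^sub>v x = c \<cdot>\<^sub>v unit_vec n 0"
  shows "\<bar>x $ (n - 1)\<bar> \<le> 2 * ((sqrt (b / a) - 1) / (sqrt (b / a) + 1)) ^ (n - 1) * vnorm x"
proof -
  note [simp] = carrier_vecD[OF x]
  have "a \<le> b"
    using lower[of "unit_vec n 0"] upper[of "unit_vec n 0"] n by simp
  then consider "n = 1" | "n > 1" "b = a" | "n > 1" "a < b" using n by linarith
  thus ?thesis
  proof cases
    case 1
    thus ?thesis using abs_index_le_vnorm[OF x, of "n - 1"] vnorm_nonneg[of x]
      by (simp del: vnorm_nonneg)
  next
    case 2
    \<comment> \<open>The interval is a single point: \<open>C\<close> acts as \<open>a I\<close>,
      so \<open>x\<close> is a multiple of the first unit vector and its last entry is 0 because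
      \<open>n > 1\<close>.\<close>
    define P where "P = C + (- a) \<cdot>\<^sub>m 1\<^sub>m n"
    have P: "P \<in> carrier_mat n n" "transpose_mat P = P"
      using carrier shift_sym[OF carrier sym] by (simp_all add: P_def)
    have Pv: "P *\<^sub>v v = C *\<^sub>v v + (- a) \<cdot>\<^sub>v v" if "v \<in> carrier_vec n" for v
      unfolding P_def using shift_mv[OF carrier that] .
    have Pq: "v \<bullet> (P *\<^sub>v v) = 0" if "v \<in> carrier_vec n" for v
      using lower[OF that] upper[OF that] 2 that by (simp add: Pv vec_bilin)
    have "psd n P" using Pq by (simp add: psd_def)
    hence "((P *\<^sub>v x) \<bullet> (P *\<^sub>v x))\<^sup>2 \<le> 0"
      using psd_cauchy_schwarz[OF P _ _ x, of "P *\<^sub>v x"] Pq[OF x] P x by simp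
    hence "P *\<^sub>v x = 0\<^sub>v n" using sp_self_eq_0[of "P *\<^sub>v x" n] P x by simp
    hence "(C *\<^sub>v x + (- a) \<cdot>\<^sub>v x) $ (n - 1) = 0" using Pv[OF x] n by simp
    hence "x $ (n - 1) = 0" unfolding Cx using 2 pos by simp
    thus ?thesis using pos 2 by simp
  next
    case 3
    \<comment> \<open>The affine map \<open>t \<mapsto> \<zeta> - e t\<close> sends
      \<open>[a, b]\<close> onto \<open>[-1, 1]\<close> and 0 to \<open>\<zeta> > 1\<close>. Hence
      \<open>S\<close> is a contraction, and \<open>C x\<close> being a multiple of the first unit
      vector makes \<open>x\<close> an eigenvector of \<open>S\<close> for \<open>\<zeta>\<close> up
      to row 0.\<close>
    define \<zeta> where "\<zeta> = (b + a) / (b - a)"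
    define e where "e = 2 / (b - a)"
    define S where "S = (- e) \<cdot>\<^sub>m C + \<zeta> \<cdot>\<^sub>m 1\<^sub>m n"
    have eC: "(- e) \<cdot>\<^sub>m C \<in> carrier_mat n n" "transpose_mat ((- e) \<cdot>\<^sub>m C) = (- e) \<cdot>\<^sub>m C"
    proof -
      show "(- e) \<cdot>\<^sub>m C \<in> carrier_mat n n" using carrier by simp
      have "transpose_mat ((- e) \<cdot>\<^sub>m C) = (- e) \<cdot>\<^sub>m transpose_mat C" by (intro eq_matI) auto
      thus "transpose_mat ((- e) \<cdot>\<^sub>m C) = (- e) \<cdot>\<^sub>m C" by (simp add: sym)
    qed
    have S: "S \<in> carrier_mat n n" "transpose_mat S = S"
      using eC shift_sym[OF eC] by (simp_all add: S_def)
    have Sv: "S *\<^sub>v v = (- e) \<cdot>\<^sub>v (C *\<^sub>v v) + \<zeta> \<cdot>\<^sub>v v" if "v \<in> carrier_vec n" for v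
    proof -
      have "((- e) \<cdot>\<^sub>m C) *\<^sub>v v = (- e) \<cdot>\<^sub>v (C *\<^sub>v v)"
        using that by (intro eq_vecI) auto
      thus ?thesis unfolding S_def using shift_mv[OF eC(1) that] by simp
    qed
    have bound: "\<bar>v \<bullet> (S *\<^sub>v v)\<bar> \<le> v \<bullet> v" if v: "v \<in> carrier_vec n" for v
    proof -
      have "v \<bullet> (S *\<^sub>v v) = ((b + a) * (v \<bullet> v) - 2 * (v \<bullet> (C *\<^sub>v v))) / (b - a)"
        using v by (simp add: Sv vec_bilin e_def \<zeta>_def diff_divide_distrib)
      also have "\<bar>\<dots>\<bar> \<le> v \<bullet> v"
        using lower[OF v] upper[OF v] 3 by (simp add: abs_le_iff field_simps)
      finally show ?thesis .
    qed
    \<comment> \<open>The larger root of \<open>r + 1/r = 2 \<zeta>\<close>, so that the Chebyshev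
      value at \<open>\<zeta>\<close> has the closed form \<open>(r^m + r^(-m)) / 2\<close>.\<close>
    define r where "r = (sqrt b + sqrt a) / (sqrt b - sqrt a)"
    have sab: "sqrt a < sqrt b" "sqrt a > 0" using 3 pos by simp_all
    have r: "r > 0" unfolding r_def using sab by (intro divide_pos_pos) linarith+
    have prod: "(sqrt b + sqrt a) * (sqrt b - sqrt a) = b - a"
      using pos 3 by (simp add: algebra_simps)
    have squares: "(sqrt b + sqrt a)\<^sup>2 + (sqrt b - sqrt a)\<^sup>2 = 2 * (b + a)"
      using pos 3 by (simp add: power2_eq_square algebra_simps)
    have "(r + inverse r) / 2 = 2 * (b + a) / (2 * (b - a))"
      unfolding r_def prod[symmetric] squares[symmetric]
      using sab by (intro half_sum_ratio_inverse) linarith+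
    also have "\<dots> = \<zeta>" unfolding \<zeta>_def by (rule mult_divide_mult_cancel_left) simp
    finally have \<zeta>: "\<zeta> = (r + inverse r) / 2" ..
    define \<tau> where "\<tau> = (\<lambda>m :: nat. (r ^ m + inverse r ^ m) / 2)"
    have \<tau>: "\<tau> 0 = 1" "\<tau> (Suc 0) = \<zeta>" "\<tau> (Suc (Suc m)) = 2 * \<zeta> * \<tau> (Suc m) - \<tau> m" for m
    proof -
      have ri: "r * (inverse r * t) = t" for t using r by simp
      show "\<tau> 0 = 1" "\<tau> (Suc 0) = \<zeta>" by (simp_all add: \<tau>_def \<zeta>)
      have eq: "(r + inverse r) * (r ^ Suc m + inverse r ^ Suc m)
          = r ^ Suc (Suc m) + inverse r ^ Suc (Suc m)
            + (r * (inverse r * inverse r ^ m) + r * (inverse r * r ^ m))"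
        by (simp only: power_Suc distrib_left distrib_right mult.left_commute mult.assoc)
      have half: "2 * (u / 2) * (t / 2) = (u * t) / 2" for u t :: real by simp
      show "\<tau> (Suc (Suc m)) = 2 * \<zeta> * \<tau> (Suc m) - \<tau> m"
        unfolding \<tau>_def \<zeta> half eq[unfolded ri] by (simp add: add_divide_distrib)
    qed
    have Sx: "S *\<^sub>v x = \<zeta> \<cdot>\<^sub>v x + (- e * c) \<cdot>\<^sub>v unit_vec n 0"
      unfolding Sv[OF x] Cx by (intro eq_vecI) simp_all
    have hess: "S $$ (i, j) = 0" if "i < n" "j + 1 < i" for i j
      using tri[OF that] that by (simp add: S_def)
    define p where "p = fst (cheb_pair S x (n - 1))"
    have p: "p \<in> carrier_vec n" using cheb_pair_carrier[OF S(1) x] by (simp add: p_def)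
    have "p \<bullet> p \<le> x \<bullet> x"
      using cheb_pair_pell[OF S x, of "n - 1"] cheb_pair_carrier[OF S(1) x, of "n - 1"]
        sym_mat_contraction[OF S bound, of "snd (cheb_pair S x (n - 1))"]
      by (simp add: p_def case_prod_beta)
    hence "vnorm p \<le> vnorm x" by (simp add: vnorm_def)
    moreover have "p $ (n - 1) = \<tau> (n - 1) * x $ (n - 1)"
      unfolding p_def using n by (intro cheb_pair_tail[OF S(1) x hess Sx \<tau>]) auto
    moreover have "\<bar>p $ (n - 1)\<bar> \<le> vnorm p"
      using abs_index_le_vnorm[OF p] n by simp
    \<comment> \<open>Dropping the inverse power is the source of the factor 2 in the bound.\<close>
    moreover have \<tau>r: "\<tau> (n - 1) \<ge> r ^ (n - 1) / 2" using r by (simp add: \<tau>_def)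
    ultimately have "r ^ (n - 1) / 2 * \<bar>x $ (n - 1)\<bar> \<le> vnorm x"
      using mult_right_mono[OF \<tau>r, of "\<bar>x $ (n - 1)\<bar>"] r
      by (simp add: abs_mult) (smt (verit) zero_less_power)
    hence "\<bar>x $ (n - 1)\<bar> \<le> 2 * (1 / r) ^ (n - 1) * vnorm x"
      using r by (simp add: field_simps)
    also have "1 / r = (sqrt (b / a) - 1) / (sqrt (b / a) + 1)"
    proof -
      have "sqrt (b / a) - 1 = (sqrt b - sqrt a) / sqrt a"
        "sqrt (b / a) + 1 = (sqrt b + sqrt a) / sqrt a"
        using sab by (simp_all add: real_sqrt_divide diff_divide_distrib add_divide_distrib)
      thus ?thesis using sab by (simp add: r_def)
    qed
    finally show ?thesis .
  qed
qed

end

section \<open>Lanczos bases\<close>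

lemma pow_mat_commute_mult_vec:
  assumes A: "A \<in> carrier_mat n n" and v: "(v :: real vec) \<in> carrier_vec n"
  shows "A *\<^sub>v ((A ^\<^sub>m l) *\<^sub>v v) = (A ^\<^sub>m Suc l) *\<^sub>v v"
proof -
  have "A * (A ^\<^sub>m l) = (A ^\<^sub>m l) * A"
  proof (induction l)
    case (Suc l)
    have "A * (A ^\<^sub>m l * A) = A * A ^\<^sub>m l * A"
      using A by (intro assoc_mult_mat[symmetric, of _ n n _ n _ n]) auto
    thus ?case using Suc by simp
  qed (use A in simp)
  hence "(A * (A ^\<^sub>m l)) *\<^sub>v v = (A ^\<^sub>m Suc l) *\<^sub>v v" by simp
  thus ?thesis using A v by (subst (asm) assoc_mult_mat_vec[of _ n n _ n]) auto
qed

lemma krylov_mult: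
  assumes A: "A \<in> carrier_mat n n" and g: "g \<in> carrier_vec n" and v: "v \<in> krylov n A g m"
  shows "A *\<^sub>v v \<in> krylov n A g (Suc m)"
proof -
  let ?K = "krylov_mat n A g"
  have K: "?K l \<in> carrier_mat n l" for l by (simp add: krylov_mat_def mat_of_cols_carrier(1)[of n "map _ [0..<l]", simplified])
  have Kij: "?K l $$ (i, j) = ((A ^\<^sub>m j) *\<^sub>v g) $ i" if "i < n" "j < l" for i j l
    using that by (simp add: krylov_mat_def mat_of_cols_index)
  obtain c where c: "c \<in> carrier_vec m" and vc: "v = ?K m *\<^sub>v c"
    using v K[of m] by (auto simp: krylov_def mat_range_def)
  \<comment> \<open>Multiplication by \<open>A\<close> shifts the coefficients in the power basis by
    one place.\<close>
  define c' where "c' = vec (Suc m) (\<lambda>l. case l of 0 \<Rightarrow> 0 | Suc l' \<Rightarrow> c $ l')"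
  have c': "c' \<in> carrier_vec (Suc m)" by (simp add: c'_def)
  have "A *\<^sub>v v = ?K (Suc m) *\<^sub>v c'"
  proof (rule eq_vecI)
    fix i assume "i < dim_vec (?K (Suc m) *\<^sub>v c')"
    hence i: "i < n" using K[of "Suc m"] by simp
    have AK: "A * ?K m \<in> carrier_mat n m" using A K by simp
    have AKij: "(A * ?K m) $$ (i, l) = ?K (Suc m) $$ (i, Suc l)" if l: "l < m" for l
    proof -
      have "col (?K m) l = (A ^\<^sub>m l) *\<^sub>v g"
        using K[of m] A l Kij by (intro eq_vecI) auto
      hence "(A * ?K m) $$ (i, l) = (A *\<^sub>v ((A ^\<^sub>m l) *\<^sub>v g)) $ i"
        using A K[of m] i l by simp
      thus ?thesis using i l by (simp add: Kij pow_mat_commute_mult_vec[OF A g] del: index_mult_mat_vec)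
    qed
    have "(A *\<^sub>v v) $ i = ((A * ?K m) *\<^sub>v c) $ i"
      unfolding vc using A K c by (subst assoc_mult_mat_vec[of _ n n _ m]) auto
    also have "\<dots> = (\<Sum>l<m. (A * ?K m) $$ (i, l) * c $ l)" by (rule index_mv_sum[OF AK c i])
    also have "\<dots> = (\<Sum>l<m. ?K (Suc m) $$ (i, Suc l) * c' $ Suc l)"
      using AKij by (intro sum.cong) (auto simp: c'_def)
    also have "\<dots> = (\<Sum>l<Suc m. ?K (Suc m) $$ (i, l) * c' $ l)"
      by (subst sum.lessThan_Suc_shift) (simp add: c'_def)
    also have "\<dots> = (?K (Suc m) *\<^sub>v c') $ i" by (rule index_mv_sum[OF K c' i, symmetric])
    finally show "(A *\<^sub>v v) $ i = (?K (Suc m) *\<^sub>v c') $ i" .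
  qed (use A K[of "Suc m"] in simp)
  thus ?thesis using c' K[of "Suc m"] by (auto simp: krylov_def mat_range_def)
qed

locale lanczos =
  fixes n k :: nat and A Q :: "real mat" and g :: "real vec"
  assumes A: "A \<in> carrier_mat n n" and Asym: "transpose_mat A = A"
    and g: "g \<in> carrier_vec n" and k: "1 \<le> k"
    and Q: "Q \<in> carrier_mat n k" and Q_on: "transpose_mat Q * Q = 1\<^sub>m k"
    and Q_kry: "\<forall>j \<in> {1..k}. mat_range (first_cols Q j) = krylov n A g j"
begin

definition "T = transpose_mat Q * A * Q"

text \<open>The last column of \<open>A Q - Q T\<close>, that is \<open>\<beta>_k q_{k+1}\<close>.
  In this form no next basis vector has to be chosen, and at breakdown it is simply zero.\<close>

definition "b = A *\<^sub>v col Q (k - 1) - Q *\<^sub>v (T *\<^sub>v unit_vec k (k - 1))"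

lemma dims [simp]: "dim_row A = n" "dim_col A = n" "dim_row Q = n" "dim_col Q = k"
  using A Q by auto

lemma T_carrier: "T \<in> carrier_mat k k"
  using A Q by (simp add: T_def)

lemma T_dims [simp]: "dim_row T = k" "dim_col T = k"
  using T_carrier by auto

lemma mult_carrier [simp]: "A *\<^sub>v v \<in> carrier_vec n" "Q *\<^sub>v v \<in> carrier_vec n"
  "T *\<^sub>v v \<in> carrier_vec k" "transpose_mat Q *\<^sub>v v \<in> carrier_vec k"
  by (simp_all add: carrier_vecI)

lemma b_carrier: "b \<in> carrier_vec n"
  by (simp add: b_def)

lemma T_sym: "transpose_mat T = T"
proof -
  have Qt: "transpose_mat Q \<in> carrier_mat k n" using Q by simp
  have "transpose_mat T = transpose_mat Q * transpose_mat (transpose_mat Q * A)"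
    unfolding T_def using A Q by (intro transpose_mult[of _ k n _ k]) auto
  also have "transpose_mat (transpose_mat Q * A) = A * Q"
    using transpose_mult[OF Qt A] Asym by simp
  also have "transpose_mat Q * (A * Q) = T"
    unfolding T_def by (rule assoc_mult_mat[OF Qt A Q, symmetric])
  finally show ?thesis .
qed

lemma QtQ [simp]: "u \<in> carrier_vec k \<Longrightarrow> transpose_mat Q *\<^sub>v (Q *\<^sub>v u) = u"
  using Q Q_on by (simp flip: assoc_mult_mat_vec[of _ k n _ k])

lemma T_mult: "u \<in> carrier_vec k \<Longrightarrow> T *\<^sub>v u = transpose_mat Q *\<^sub>v (A *\<^sub>v (Q *\<^sub>v u))"
  unfolding T_def using A Q by (simp add: assoc_mult_mat_vec[of _ k n _ k] assoc_mult_mat_vec[of _ k n _ n])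

lemma Qt_sp: "u \<in> carrier_vec k \<Longrightarrow> v \<in> carrier_vec n \<Longrightarrow> (transpose_mat Q *\<^sub>v v) \<bullet> u = v \<bullet> (Q *\<^sub>v u)"
  by (rule transpose_vec_mult_scalar[OF Q])

lemma Q_sp: "u \<in> carrier_vec k \<Longrightarrow> v \<in> carrier_vec k \<Longrightarrow> (Q *\<^sub>v u) \<bullet> (Q *\<^sub>v v) = u \<bullet> v"
  using Qt_sp[of v "Q *\<^sub>v u"] by simp

lemma Q_unit: "j < k \<Longrightarrow> Q *\<^sub>v unit_vec k j = col Q j"
  using Q by (intro eq_vecI) auto

text \<open>Counting columns from 0, \<open>col Q j\<close> lies in the Krylov space of dimension
  index \<open>j + 1\<close>. Its image under \<open>A\<close> lies in the next one, which the first
  \<open>j + 2\<close> columns span.\<close>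

lemma mult_col:
  assumes j: "j + 1 < k"
  obtains c where "c \<in> carrier_vec k" "A *\<^sub>v col Q j = Q *\<^sub>v c" "\<And>i. i < k \<Longrightarrow> j + 1 < i \<Longrightarrow> c $ i = 0"
proof -
  have F: "first_cols Q m \<in> carrier_mat n m" for m
    by (simp add: first_cols_def mat_of_cols_carrier(1)[of n "map _ [0..<m]", simplified])
  have Fij: "first_cols Q m $$ (i, l) = Q $$ (i, l)" if "i < n" "l < m" "m \<le> k" for i l m
    using that by (simp add: first_cols_def mat_of_cols_index)
  have "col Q j = first_cols Q (Suc j) *\<^sub>v unit_vec (Suc j) j"
    using F[of "Suc j"] j by (intro eq_vecI) (auto simp: Fij)
  hence "col Q j \<in> mat_range (first_cols Q (Suc j))"
    using F[of "Suc j"] by (auto simp: mat_range_def)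
  hence "col Q j \<in> krylov n A g (Suc j)" using Q_kry j by simp
  hence "A *\<^sub>v col Q j \<in> krylov n A g (Suc (Suc j))" by (rule krylov_mult[OF A g])
  hence "A *\<^sub>v col Q j \<in> mat_range (first_cols Q (Suc (Suc j)))" using Q_kry j by simp
  then obtain d where d: "d \<in> carrier_vec (Suc (Suc j))"
    and Aq: "A *\<^sub>v col Q j = first_cols Q (Suc (Suc j)) *\<^sub>v d"
    using F[of "Suc (Suc j)"] by (auto simp: mat_range_def)
  define c where "c = vec k (\<lambda>i. if i < Suc (Suc j) then d $ i else 0)"
  have c: "c \<in> carrier_vec k" by (simp add: c_def)
  have "first_cols Q (Suc (Suc j)) *\<^sub>v d = Q *\<^sub>v c"
  proof (rule eq_vecI)
    fix i assume "i < dim_vec (Q *\<^sub>v c)"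
    hence i: "i < n" by simp
    have "(first_cols Q (Suc (Suc j)) *\<^sub>v d) $ i = (\<Sum>l<Suc (Suc j). Q $$ (i, l) * c $ l)"
      unfolding index_mv_sum[OF F d i] using i j by (intro sum.cong) (auto simp: Fij c_def)
    also have "\<dots> = (\<Sum>l<k. Q $$ (i, l) * c $ l)"
      using j by (intro sum.mono_neutral_left) (auto simp: c_def)
    also have "\<dots> = (Q *\<^sub>v c) $ i" by (rule index_mv_sum[OF Q c i, symmetric])
    finally show "(first_cols Q (Suc (Suc j)) *\<^sub>v d) $ i = (Q *\<^sub>v c) $ i" .
  qed (use F[of "Suc (Suc j)"] in simp)
  thus ?thesis using that[of c] c Aq by (auto simp: c_def)
qed

lemma T_unit:
  assumes "j + 1 < k" "c \<in> carrier_vec k" "A *\<^sub>v col Q j = Q *\<^sub>v c"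
  shows "T *\<^sub>v unit_vec k j = c"
  using assms by (simp add: T_mult Q_unit)

lemma T_hessenberg:
  assumes "i < k" "j + 1 < i"
  shows "T $$ (i, j) = 0"
proof -
  obtain c where c: "c \<in> carrier_vec k" "A *\<^sub>v col Q j = Q *\<^sub>v c" "c $ i = 0"
    using mult_col[of j] assms by (metis order.strict_trans)
  have "T $$ (i, j) = (T *\<^sub>v unit_vec k j) $ i" using assms by simp
  thus ?thesis using T_unit[of j c] c assms by simp
qed

text \<open>For every column but the last, \<open>A\<close> maps it into the range of
  \<open>Q\<close> with coordinates given by the column of \<open>T\<close>. So
  \<open>A Q - Q T\<close> has only its last column, \<open>b\<close>, left.\<close>

lemma lanczos_relation:
  assumes u: "u \<in> carrier_vec k"
  shows "A *\<^sub>v (Q *\<^sub>v u) = Q *\<^sub>v (T *\<^sub>v u) + u $ (k - 1) \<cdot>\<^sub>v b"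
proof -
  define D where "D = A * Q - Q * T"
  have D: "D \<in> carrier_mat n k" unfolding D_def by (rule minus_carrier_mat, rule mult_carrier_mat[OF Q T_carrier])
  have Dv: "D *\<^sub>v v = A *\<^sub>v (Q *\<^sub>v v) - Q *\<^sub>v (T *\<^sub>v v)" if "v \<in> carrier_vec k" for v
    unfolding D_def using A Q T_carrier that
    by (simp add: minus_mult_distrib_mat_vec[of _ n k] assoc_mult_mat_vec[of _ n n _ k]
        assoc_mult_mat_vec[of _ n k _ k])
  have D0: "D $$ (i, j) = 0" if ij: "i < n" "j + 1 < k" for i j
  proof -
    obtain c where c: "c \<in> carrier_vec k" "A *\<^sub>v col Q j = Q *\<^sub>v c"
      using mult_col[OF ij(2)] by blast
    have "D *\<^sub>v unit_vec k j = 0\<^sub>v n"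
      using ij c T_unit[OF ij(2) c] by (simp add: Dv Q_unit)
    moreover have "(D *\<^sub>v unit_vec k j) $ i = D $$ (i, j)" using ij D by simp
    ultimately show ?thesis using ij by simp
  qed
  have "D *\<^sub>v u = u $ (k - 1) \<cdot>\<^sub>v b"
  proof (rule eq_vecI)
    fix i assume "i < dim_vec (u $ (k - 1) \<cdot>\<^sub>v b)"
    hence i: "i < n" using b_carrier by simp
    have "(D *\<^sub>v u) $ i = (\<Sum>l<k. D $$ (i, l) * u $ l)" by (rule index_mv_sum[OF D u i])
    also have "\<dots> = (\<Sum>l\<in>{k - 1}. D $$ (i, l) * u $ l)"
      using k i D0 by (intro sum.mono_neutral_right) auto
    also have "\<dots> = D $$ (i, k - 1) * u $ (k - 1)" by simp
    also have "D $$ (i, k - 1) = (D *\<^sub>v unit_vec k (k - 1)) $ i" using i k D by simp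
    also have "D *\<^sub>v unit_vec k (k - 1) = b" using k by (simp add: Dv Q_unit b_def)
    finally show "(D *\<^sub>v u) $ i = (u $ (k - 1) \<cdot>\<^sub>v b) $ i" using i b_carrier by simp
  qed (use D b_carrier in simp)
  hence "A *\<^sub>v (Q *\<^sub>v u) - Q *\<^sub>v (T *\<^sub>v u) = u $ (k - 1) \<cdot>\<^sub>v b" using Dv[OF u] by simp
  moreover have "A *\<^sub>v (Q *\<^sub>v u) = Q *\<^sub>v (T *\<^sub>v u) + (A *\<^sub>v (Q *\<^sub>v u) - Q *\<^sub>v (T *\<^sub>v u))"
    by (intro eq_vecI) (simp_all del: index_mult_mat_vec)
  ultimately show ?thesis by simp
qed

lemma b_orth:
  assumes u: "u \<in> carrier_vec k"
  shows "b \<bullet> (Q *\<^sub>v u) = 0"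
proof -
  have "transpose_mat Q *\<^sub>v b = 0\<^sub>v k"
    using k by (simp add: b_def mv_diff T_mult Q_unit)
  thus ?thesis using Qt_sp[OF u b_carrier] u by simp
qed

end

section \<open>The bound on the multipliers\<close>

lemma sin_angle_smult:
  assumes W: "W \<in> carrier_mat n m" and z: "z \<in> carrier_vec n" and d: "d \<noteq> 0"
  shows "sin_angle (d \<cdot>\<^sub>v z) W = sin_angle z W"
proof -
  note [simp] = carrier_matD[OF W] carrier_vecD[OF z]
  have "d \<cdot>\<^sub>v z - W *\<^sub>v (transpose_mat W *\<^sub>v (d \<cdot>\<^sub>v z)) = d \<cdot>\<^sub>v (z - W *\<^sub>v (transpose_mat W *\<^sub>v z))"
    by (intro eq_vecI) (simp_all add: mv_smult right_diff_distrib del: index_mult_mat_vec)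
  thus ?thesis using d by (simp add: sin_angle_def vnorm_smult)
qed

text \<open>The block projector acts on the two halves separately, so the squared residual of
  \<open>y\<close> is the sum of those of \<open>y1\<close> and \<open>y2\<close>.\<close>

lemma vnorm_proj_le_block:
  assumes Q: "Q \<in> carrier_mat n k" and y1: "y1 \<in> carrier_vec n" and y2: "y2 \<in> carrier_vec n"
  defines "S \<equiv> four_block_mat Q (0\<^sub>m n k) (0\<^sub>m n k) Q" and "y \<equiv> y1 @\<^sub>v y2"
  shows "vnorm (y2 - Q *\<^sub>v (transpose_mat Q *\<^sub>v y2)) \<le> vnorm (y - S *\<^sub>v (transpose_mat S *\<^sub>v y))"
proof -
  let ?P = "\<lambda>v. Q *\<^sub>v (transpose_mat Q *\<^sub>v v)"
  note [simp] = carrier_matD[OF Q] carrier_vecD[OF y1] carrier_vecD[OF y2]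
  have Qt: "transpose_mat Q \<in> carrier_mat k n" using Q by simp
  have zv: "0\<^sub>m p q *\<^sub>v v = 0\<^sub>v p" if "v \<in> carrier_vec q" for p q and v :: "real vec"
    using that by (intro eq_vecI) auto
  have St: "transpose_mat S = four_block_mat (transpose_mat Q) (0\<^sub>m k n) (0\<^sub>m k n) (transpose_mat Q)"
    unfolding S_def using Q by (subst transpose_four_block_mat[of _ n k _ k _ n]) auto
  have 1: "transpose_mat S *\<^sub>v y = transpose_mat Q *\<^sub>v y1 @\<^sub>v transpose_mat Q *\<^sub>v y2"
    unfolding St y_def using Qt y1 y2
    by (subst four_block_mat_mult_vec[of _ k n _ n _ k]) (auto simp: zv)
  have 2: "S *\<^sub>v (transpose_mat S *\<^sub>v y) = ?P y1 @\<^sub>v ?P y2"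
    unfolding 1 unfolding S_def using Q Qt y1 y2
    by (subst four_block_mat_mult_vec[of _ n k _ k _ n]) (auto simp: zv)
  have "y - (?P y1 @\<^sub>v ?P y2) = (y1 - ?P y1) @\<^sub>v (y2 - ?P y2)"
    by (intro eq_vecI) (simp_all add: y_def del: index_mult_mat_vec)
  moreover have "((y1 - ?P y1) @\<^sub>v (y2 - ?P y2)) \<bullet> ((y1 - ?P y1) @\<^sub>v (y2 - ?P y2))
      = (y1 - ?P y1) \<bullet> (y1 - ?P y1) + (y2 - ?P y2) \<bullet> (y2 - ?P y2)"
    by (rule scalar_prod_append[of _ n _ n]) (auto intro: carrier_vecI)
  ultimately show ?thesis unfolding 2 vnorm_def by simp
qed

text \<open>Reading off the two block rows shows that the square of the shifted matrix maps
  \<open>y2\<close> to a multiple of \<open>g\<close>; this ties \<open>y2\<close> to the solution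
  of the shifted system.\<close>

lemma Mmat_eigenvector_blocks:
  assumes A: "A \<in> carrier_mat n n" and g: "g \<in> carrier_vec n"
    and y1: "y1 \<in> carrier_vec n" and y2: "y2 \<in> carrier_vec n"
    and eig: "Mmat n A g \<Delta> *\<^sub>v (y1 @\<^sub>v y2) = l \<cdot>\<^sub>v (y1 @\<^sub>v y2)"
  shows "(A + l \<cdot>\<^sub>m 1\<^sub>m n) *\<^sub>v y2 = y1"
    and "(A + l \<cdot>\<^sub>m 1\<^sub>m n) *\<^sub>v y1 = ((g \<bullet> y2) / \<Delta>\<^sup>2) \<cdot>\<^sub>v g"
proof -
  note [simp] = carrier_matD[OF A] carrier_vecD[OF y1] carrier_vecD[OF y2] carrier_vecD[OF g]
  let ?G = "(1 / \<Delta>^2) \<cdot>\<^sub>m mat n n (\<lambda>(i,j). g $ i * g $ j)"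
  have Gy: "?G *\<^sub>v y2 = ((g \<bullet> y2) / \<Delta>\<^sup>2) \<cdot>\<^sub>v g"
    by (intro eq_vecI) (auto simp: scalar_prod_def sum_distrib_left sum_distrib_right sum_divide_distrib
        intro!: sum.cong)
  have "(- A *\<^sub>v y1 + ?G *\<^sub>v y2) @\<^sub>v (1\<^sub>m n *\<^sub>v y1 + - A *\<^sub>v y2) = (l \<cdot>\<^sub>v y1) @\<^sub>v (l \<cdot>\<^sub>v y2)"
  proof -
    have "(l \<cdot>\<^sub>v y1) @\<^sub>v (l \<cdot>\<^sub>v y2) = l \<cdot>\<^sub>v (y1 @\<^sub>v y2)"
      by (intro eq_vecI) auto
    thus ?thesis using eig A y1 y2 unfolding Mmat_def
      by (subst (asm) four_block_mat_mult_vec[of _ n n _ n _ n]) auto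
  qed
  hence "- A *\<^sub>v y1 + ?G *\<^sub>v y2 = l \<cdot>\<^sub>v y1 \<and> 1\<^sub>m n *\<^sub>v y1 + - A *\<^sub>v y2 = l \<cdot>\<^sub>v y2"
    by (subst (asm) append_vec_eq[of _ n]) (auto intro: carrier_vecI)
  hence e: "- (A *\<^sub>v y1) + ((g \<bullet> y2) / \<Delta>\<^sup>2) \<cdot>\<^sub>v g = l \<cdot>\<^sub>v y1" "y1 + - (A *\<^sub>v y2) = l \<cdot>\<^sub>v y2"
    unfolding Gy using y1 y2 by simp_all
  show "(A + l \<cdot>\<^sub>m 1\<^sub>m n) *\<^sub>v y2 = y1"
    unfolding shift_mv[OF A y2] e(2)[symmetric]
    by (intro eq_vecI) (simp_all del: index_mult_mat_vec)
  show "(A + l \<cdot>\<^sub>m 1\<^sub>m n) *\<^sub>v y1 = ((g \<bullet> y2) / \<Delta>\<^sup>2) \<cdot>\<^sub>v g"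
    unfolding shift_mv[OF A y1] e(1)[symmetric]
    by (intro eq_vecI) (simp_all del: index_mult_mat_vec)
qed

theorem theorem5p3:
  fixes n k :: nat and A Q :: "real mat" and g xopt h y :: "real vec"
    and \<Delta> lopt lk :: real
  assumes A: "A \<in> carrier_mat n n" and Asym: "transpose_mat A = A"
    and g: "g \<in> carrier_vec n" and gnz: "g \<noteq> 0\<^sub>v n"
    and Dpos: "\<Delta> > 0"
    \<comment> \<open>x_opt: global minimizer of the TRS with multiplier lambda_opt\<close>
    and xopt: "xopt \<in> carrier_vec n" and xopt_feas: "vnorm xopt \<le> \<Delta>"
    and xopt_min: "\<forall>x \<in> carrier_vec n. vnorm x \<le> \<Delta> \<longrightarrow> trs_obj A g xopt \<le> trs_obj A g x"
    and lopt_nn: "lopt \<ge> 0"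
    and lopt_eq: "(A + lopt \<cdot>\<^sub>m 1\<^sub>m n) *\<^sub>v xopt = - g"
    and lopt_cs: "lopt * (\<Delta> - vnorm xopt) = 0"
    and lopt_psd: "psd n (A + lopt \<cdot>\<^sub>m 1\<^sub>m n)"
    \<comment> \<open>easy case\<close>
    and easy: "lopt > - Min {a. eigenvalue A a}"
    and xopt_bd: "vnorm xopt = \<Delta>"
    \<comment> \<open>Lanczos basis Q_k of K_k(A,g)\<close>
    and k: "1 \<le> k" "k \<le> kmax n A g"
    and Q: "Q \<in> carrier_mat n k"
    and Q_on: "transpose_mat Q * Q = 1\<^sub>m k"
    and Q_1: "col Q 0 = (1 / vnorm g) \<cdot>\<^sub>v g"
    and Q_kry: "\<forall>j \<in> {1..k}. mat_range (first_cols Q j) = krylov n A g j"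
    \<comment> \<open>GLTR iterate h_k with multiplier lambda_k\<close>
    and h: "h \<in> carrier_vec k" and h_feas: "vnorm h \<le> \<Delta>"
    and h_min: "\<forall>u \<in> carrier_vec k. vnorm u \<le> \<Delta> \<longrightarrow>
        trs_obj (transpose_mat Q * A * Q) (vnorm g \<cdot>\<^sub>v unit_vec k 0) h
        \<le> trs_obj (transpose_mat Q * A * Q) (vnorm g \<cdot>\<^sub>v unit_vec k 0) u"
    and lk_nn: "lk \<ge> 0"
    and lk_eq: "(transpose_mat Q * A * Q + lk \<cdot>\<^sub>m 1\<^sub>m k) *\<^sub>v h = - (vnorm g \<cdot>\<^sub>v unit_vec k 0)"
    and lk_cs: "lk * (\<Delta> - vnorm h) = 0"
    and lk_psd: "psd k (transpose_mat Q * A * Q + lk \<cdot>\<^sub>m 1\<^sub>m k)"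
    and xk_bd: "vnorm (Q *\<^sub>v h) = \<Delta>"
    \<comment> \<open>unit eigenvector y of M for lambda_opt\<close>
    and y: "y \<in> carrier_vec (2 * n)" and y_unit: "vnorm y = 1"
    and y_eig: "Mmat n A g \<Delta> *\<^sub>v y = lopt \<cdot>\<^sub>v y"
  shows
    "let T = transpose_mat Q * A * Q;
         Tl = T + lopt \<cdot>\<^sub>m 1\<^sub>m k;
         e1 = unit_vec k 0;
         Aopt = A + lopt \<cdot>\<^sub>m 1\<^sub>m n;
         \<beta> = vnorm (A *\<^sub>v col Q (k - 1) - Q *\<^sub>v (T *\<^sub>v unit_vec k (k - 1)));
         y2 = vec n (\<lambda>i. y $ (n + i));
         ht = - (vnorm g \<cdot>\<^sub>v (minv Tl *\<^sub>v e1));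
         xt = Q *\<^sub>v ht;
         rt = Aopt *\<^sub>v xt + g;
         s = vnorm (minv Aopt *\<^sub>v xopt) / (vnorm g * (e1 \<bullet> ((minv Tl ^\<^sub>m 3) *\<^sub>v e1)));
         \<alpha>1 = Max {a. eigenvalue A a};
         \<alpha>n = Min {a. eigenvalue A a};
         \<kappa> = (\<alpha>1 + lopt) / (\<alpha>n + lopt);
         S = four_block_mat Q (0\<^sub>m n k) (0\<^sub>m n k) Q
     in lopt - lk \<le> s * (vnorm rt / vnorm g) * sin_angle y2 Q
      \<and> s * (vnorm rt / vnorm g) * sin_angle y2 Q
        \<le> s * (2 * \<beta> * \<Delta> / (vnorm y2 * vnorm g))
            * ((sqrt \<kappa> - 1) / (sqrt \<kappa> + 1)) ^ (k - 1) * sin_angle y S"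
proof -

  \<comment> \<open>Shifted matrices and their spectral bounds\<close>
  interpret L: lanczos n k A Q g
    using A Asym g k Q Q_on Q_kry by unfold_locales
  define B where "B = A + lopt \<cdot>\<^sub>m 1\<^sub>m n"
  define C where "C = L.T + lopt \<cdot>\<^sub>m 1\<^sub>m k"
  define lo where "lo = Min {a. eigenvalue A a} + lopt"
  define hi where "hi = Max {a. eigenvalue A a} + lopt"
  define e1 where "e1 = (unit_vec k 0 :: real vec)"
  have n0: "n > 0"
  proof (rule ccontr)
    assume "\<not> n > 0"
    hence "g = 0\<^sub>v n" using g by (intro eq_vecI) auto
    thus False using gnz by simp
  qed
  have e1: "e1 \<in> carrier_vec k" "e1 \<bullet> e1 = 1" using k by (simp_all add: e1_def)
  define \<gamma> where "\<gamma> = vnorm g"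
  have \<gamma>: "\<gamma> > 0" using vnorm_pos[OF g gnz] by (simp add: \<gamma>_def)
  have Bv: "B *\<^sub>v v = A *\<^sub>v v + lopt \<cdot>\<^sub>v v" if "v \<in> carrier_vec n" for v
    unfolding B_def by (rule shift_mv[OF A that])
  have Cv: "C *\<^sub>v v = L.T *\<^sub>v v + lopt \<cdot>\<^sub>v v" if "v \<in> carrier_vec k" for v
    unfolding C_def by (rule shift_mv[OF L.T_carrier that])
  have Blo: "lo * (v \<bullet> v) \<le> v \<bullet> (B *\<^sub>v v)" and Bhi: "v \<bullet> (B *\<^sub>v v) \<le> hi * (v \<bullet> v)"
    if "v \<in> carrier_vec n" for v
    using rayleigh_bounds[OF A Asym that n0] that
    by (simp_all add: Bv vec_bilin lo_def hi_def distrib_right)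
  have BQ: "B *\<^sub>v (Q *\<^sub>v u) = Q *\<^sub>v (C *\<^sub>v u) + u $ (k - 1) \<cdot>\<^sub>v L.b" if u: "u \<in> carrier_vec k" for u
    using u L.b_carrier
    by (intro eq_vecI) (simp_all add: Bv Cv L.lanczos_relation vec_bilin del: index_mult_mat_vec)
  \<comment> \<open>The Lanczos remainder is orthogonal to the range of \<open>Q\<close>, so
    \<open>C\<close> is the compression of \<open>B\<close> and inherits both bounds
    \<open>lo\<close> and \<open>hi\<close>.\<close>
  have Cform: "u \<bullet> (C *\<^sub>v u) = (Q *\<^sub>v u) \<bullet> (B *\<^sub>v (Q *\<^sub>v u))" if u: "u \<in> carrier_vec k" for u
  proof -
    have "C *\<^sub>v u \<in> carrier_vec k" using u by (simp add: Cv)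
    thus ?thesis
      using u L.b_carrier L.b_orth[OF u] sp_comm[of "Q *\<^sub>v u" L.b]
      by (simp add: BQ vec_bilin L.Q_sp)
  qed
  interpret B: coercive_sym_mat n B lo
  proof
    show "B \<in> carrier_mat n n" "transpose_mat B = B"
      using A shift_sym[OF A Asym] by (simp_all add: B_def)
    show "lo > 0" using easy by (simp add: lo_def)
  qed (rule Blo)
  interpret C: tridiagonal_coercive_mat k C lo
  proof
    show "C \<in> carrier_mat k k" "transpose_mat C = C"
      using L.T_carrier shift_sym[OF L.T_carrier L.T_sym] by (simp_all add: C_def)
    show "lo > 0" by (rule B.pos)
    show "lo * (u \<bullet> u) \<le> u \<bullet> (C *\<^sub>v u)" if "u \<in> carrier_vec k" for u
      using Blo[of "Q *\<^sub>v u"] that by (simp add: Cform L.Q_sp)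
    show "C $$ (i, j) = 0" if "i < k" "j + 1 < i" for i j
      using L.T_hessenberg[OF that] that by (simp add: C_def)
  qed
  have Chi: "u \<bullet> (C *\<^sub>v u) \<le> hi * (u \<bullet> u)" if "u \<in> carrier_vec k" for u
    using Bhi[of "Q *\<^sub>v u"] that by (simp add: Cform L.Q_sp)
  have lohi: "lo \<le> hi"
    using C.lower[OF e1(1)] Chi[OF e1(1)] e1(2) by simp

  \<comment> \<open>The Galerkin solution and its residual\<close>
  define G where "G = minv C"
  define ht where "ht = - (\<gamma> \<cdot>\<^sub>v (G *\<^sub>v e1))"
  define rt where "rt = B *\<^sub>v (Q *\<^sub>v ht) + g"
  define \<eta> where "\<eta> = ht $ (k - 1)"
  define E where "E = e1 \<bullet> (G ^\<^sub>m 3 *\<^sub>v e1)"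
  define z where "z = minv B *\<^sub>v xopt"
  define Pz where "Pz = z - Q *\<^sub>v (transpose_mat Q *\<^sub>v z)"
  have Ge1: "G *\<^sub>v e1 \<in> carrier_vec k" by (simp add: G_def)
  have ht_smult: "ht = (- \<gamma>) \<cdot>\<^sub>v (G *\<^sub>v e1)" unfolding ht_def by (intro eq_vecI) auto
  have ht: "ht \<in> carrier_vec k" using Ge1 by (simp add: ht_def)
  have Cht: "C *\<^sub>v ht = (- \<gamma>) \<cdot>\<^sub>v e1"
    unfolding ht_smult using e1 Ge1 by (simp add: mv_smult G_def)
  have Qe1: "Q *\<^sub>v (\<gamma> \<cdot>\<^sub>v e1) = g"
    using Q_1 \<gamma> k e1 by (simp add: mv_smult e1_def L.Q_unit \<gamma>_def smult_smult_assoc)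
  \<comment> \<open>The Galerkin equation cancels the part inside the range of \<open>Q\<close>;
    only the Lanczos remainder survives.\<close>
  have rt_b: "rt = \<eta> \<cdot>\<^sub>v L.b"
  proof -
    have "Q *\<^sub>v (C *\<^sub>v ht) = - g"
      unfolding Cht Qe1[symmetric] using e1
      by (intro eq_vecI) (simp_all add: mv_smult del: index_mult_mat_vec)
    thus ?thesis unfolding rt_def BQ[OF ht] \<eta>_def using g L.b_carrier
      by (intro eq_vecI) auto
  qed
  have rt: "rt \<in> carrier_vec n" using L.b_carrier by (simp add: rt_b)
  have z: "z \<in> carrier_vec n" by (simp add: z_def)
  have Pz: "Pz \<in> carrier_vec n" by (simp add: Pz_def z)
  have Bx: "B *\<^sub>v xopt = - g" using lopt_eq by (simp add: B_def)
  have res: "B *\<^sub>v (Q *\<^sub>v ht) - B *\<^sub>v xopt = rt"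
    unfolding Bx rt_def using g by (intro eq_vecI) (simp_all del: index_mult_mat_vec)
  have xx: "xopt \<bullet> xopt = \<Delta>\<^sup>2" using xopt_bd vnorm_sq[of xopt] by simp
  have hh: "h \<bullet> h = \<Delta>\<^sup>2" using xk_bd vnorm_sq[of "Q *\<^sub>v h"] h by (simp add: L.Q_sp)

  \<comment> \<open>Up to the factor \<open>\<gamma>^2\<close>, the denominator in the constant
    \<open>s\<close> is the slope term of the tangent inequality
    \<open>norm_sq_shift_lower\<close>.\<close>
  have E: "\<gamma>\<^sup>2 * E = ht \<bullet> (G *\<^sub>v ht)" and Epos: "E > 0"
  proof -
    have Gc: "G \<in> carrier_mat k k" using C.minv_inverse(1) by (simp add: G_def)
    have "G ^\<^sub>m 3 = G * G * G" using Gc by (simp add: numeral_3_eq_3)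
    hence "G ^\<^sub>m 3 *\<^sub>v e1 = G *\<^sub>v (G *\<^sub>v (G *\<^sub>v e1))"
      using Gc e1 by (simp add: assoc_mult_mat_vec[of _ k k _ k])
    hence EG: "E = (G *\<^sub>v e1) \<bullet> (G *\<^sub>v (G *\<^sub>v e1))"
      unfolding E_def G_def using e1 by (simp add: C.minv_sp)
    have [simp]: "dim_row G = k" "dim_col G = k" using Gc by auto
    show "\<gamma>\<^sup>2 * E = ht \<bullet> (G *\<^sub>v ht)"
      unfolding EG ht_smult by (simp add: vec_bilin power2_eq_square)
    have "G *\<^sub>v e1 \<noteq> 0\<^sub>v k"
    proof
      assume "G *\<^sub>v e1 = 0\<^sub>v k"
      hence "e1 = 0\<^sub>v k" using C.mult_minv[OF e1(1)] mv_zero[OF C.carrier] by (simp add: G_def)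
      thus False using e1 by simp
    qed
    thus "E > 0" unfolding EG using C.minv_form_pos[OF Ge1] by (simp add: G_def)
  qed

  \<comment> \<open>The multiplier gap\<close>
  have rt_z: "rt \<bullet> z = rt \<bullet> Pz"
  proof -
    have "rt \<bullet> (Q *\<^sub>v (transpose_mat Q *\<^sub>v z)) = 0"
      using L.b_carrier L.b_orth by (simp add: rt_b vec_bilin)
    thus ?thesis using z rt by (simp add: Pz_def vec_bilin)
  qed
  have gap: "(lopt - lk) * (\<gamma>\<^sup>2 * E) \<le> vnorm rt * vnorm Pz"
  proof (cases "lopt \<le> lk")
    case True
    hence "(lopt - lk) * (\<gamma>\<^sup>2 * E) \<le> 0" using Epos by (intro mult_nonpos_nonneg) auto
    thus ?thesis using mult_nonneg_nonneg[OF vnorm_nonneg vnorm_nonneg, of rt Pz] by linarith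
  next
    case False
    have Tlk: "(L.T + lk \<cdot>\<^sub>m 1\<^sub>m k) *\<^sub>v v = C *\<^sub>v v - (lopt - lk) \<cdot>\<^sub>v v" if "v \<in> carrier_vec k" for v
      unfolding shift_mv[OF L.T_carrier that] Cv[OF that] using that
      by (intro eq_vecI) (simp_all add: algebra_simps del: index_mult_mat_vec)
    \<comment> \<open>The tangent inequality with \<open>\<delta> = lopt - lk\<close>: then
      \<open>C - \<delta> I\<close> is \<open>T + lk I\<close>, which is positive semidefinite and
      sends \<open>h\<close> to the same vector \<open>- \<gamma> e1\<close> as \<open>C\<close>
      sends \<open>ht\<close>.\<close>
    have "2 * (lopt - lk) * (ht \<bullet> (minv C *\<^sub>v ht)) \<le> h \<bullet> h - ht \<bullet> ht"
    proof (rule C.norm_sq_shift_lower[OF h ht])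
      have "(L.T + lk \<cdot>\<^sub>m 1\<^sub>m k) *\<^sub>v h = - (\<gamma> \<cdot>\<^sub>v e1)"
        using lk_eq by (simp add: L.T_def \<gamma>_def e1_def)
      also have "\<dots> = C *\<^sub>v ht" unfolding Cht by (intro eq_vecI) auto
      finally show "C *\<^sub>v h - (lopt - lk) \<cdot>\<^sub>v h = C *\<^sub>v ht" unfolding Tlk[OF h] .
      show "(lopt - lk) * (w \<bullet> w) \<le> w \<bullet> (C *\<^sub>v w)" if w: "w \<in> carrier_vec k" for w
      proof -
        have "w \<bullet> ((L.T + lk \<cdot>\<^sub>m 1\<^sub>m k) *\<^sub>v w) \<ge> 0"
          using lk_psd w by (simp add: psd_def L.T_def)
        thus ?thesis using w by (simp add: Tlk vec_bilin)
      qed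
    qed (use False in simp)
    \<comment> \<open>Here both boundary conditions enter: \<open>h\<close> and \<open>xopt\<close>
      have the same norm \<Delta>.\<close>
    also have "\<dots> = xopt \<bullet> xopt - (Q *\<^sub>v ht) \<bullet> (Q *\<^sub>v ht)" using ht by (simp add: hh xx L.Q_sp)
    also have "\<dots> \<le> - 2 * (rt \<bullet> z)"
      using B.residual_norm_sq_diff[OF xopt L.mult_carrier(2), of ht] by (simp add: res z_def)
    also have "\<dots> \<le> 2 * (vnorm rt * vnorm Pz)"
      using cauchy_schwarz[OF rt Pz] unfolding rt_z by linarith
    finally show ?thesis unfolding E G_def by linarith
  qed

  \<comment> \<open>Geometric decay of the residual\<close>
  have ht_le: "vnorm ht \<le> \<Delta>"
  proof -
    \<comment> \<open>\<open>B\<close> maps this lift of the inverse applied to \<open>ht\<close> to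
      \<open>Q ht\<close> plus a multiple of \<open>b\<close>. Its coefficient and
      \<open>\<eta>\<close> are last entries of \<open>- \<gamma> G (G e1)\<close> and
      \<open>- \<gamma> G e1\<close>, so \<open>minv_corner_sign\<close> gives the sign of their
      product.\<close>
    define w where "w = Q *\<^sub>v (G *\<^sub>v ht)"
    have Ght: "G *\<^sub>v ht \<in> carrier_vec k" by (simp add: G_def)
    have "(Q *\<^sub>v ht) \<bullet> (Q *\<^sub>v ht) \<le> xopt \<bullet> xopt"
    proof (rule B.galerkin_norm_sq_le[OF xopt L.mult_carrier(2) _ L.b_carrier])
      show "B *\<^sub>v (Q *\<^sub>v ht) - B *\<^sub>v xopt = \<eta> \<cdot>\<^sub>v L.b" unfolding res rt_b ..
      show "w \<in> carrier_vec n" by (simp add: w_def)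
      show "B *\<^sub>v w = Q *\<^sub>v ht + (G *\<^sub>v ht) $ (k - 1) \<cdot>\<^sub>v L.b"
        unfolding w_def BQ[OF Ght] using ht by (simp add: G_def del: index_mult_mat_vec)
      show "L.b \<bullet> w = 0" unfolding w_def by (rule L.b_orth[OF Ght])
      have "(G *\<^sub>v ht) $ (k - 1) = - \<gamma> * (G *\<^sub>v (G *\<^sub>v e1)) $ (k - 1)"
        unfolding ht_smult using Ge1 k by (simp add: mv_smult G_def del: index_mult_mat_vec)
      moreover have "\<eta> = - \<gamma> * (G *\<^sub>v e1) $ (k - 1)"
        unfolding \<eta>_def ht_smult using k by (simp add: G_def del: index_mult_mat_vec)
      ultimately have "(G *\<^sub>v ht) $ (k - 1) * \<eta>
          = \<gamma>\<^sup>2 * ((G *\<^sub>v (G *\<^sub>v e1)) $ (k - 1) * (G *\<^sub>v e1) $ (k - 1))"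
        by (simp add: power2_eq_square del: index_mult_mat_vec)
      thus "(G *\<^sub>v ht) $ (k - 1) * \<eta> \<ge> 0"
        using C.minv_corner_sign k unfolding G_def e1_def by (simp del: index_mult_mat_vec)
    qed
    hence "ht \<bullet> ht \<le> \<Delta>\<^sup>2" using ht by (simp add: xx L.Q_sp)
    thus ?thesis unfolding vnorm_def using Dpos by (intro real_le_lsqrt) auto
  qed

  define \<rho> where "\<rho> = (sqrt (hi / lo) - 1) / (sqrt (hi / lo) + 1)"
  have \<rho>: "\<rho> \<ge> 0"
  proof -
    have "sqrt (hi / lo) \<ge> 1" using lohi B.pos by simp
    thus ?thesis by (simp add: \<rho>_def)
  qed
  have rt_le: "vnorm rt \<le> 2 * vnorm L.b * \<Delta> * \<rho> ^ (k - 1)"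
  proof -
    have "\<bar>\<eta>\<bar> \<le> 2 * \<rho> ^ (k - 1) * vnorm ht"
      unfolding \<eta>_def \<rho>_def using k Cht by (intro C.last_component_bound[OF _ Chi ht]) (auto simp: e1_def)
    also have "\<dots> \<le> 2 * \<rho> ^ (k - 1) * \<Delta>"
      using ht_le \<rho> by (intro mult_left_mono) auto
    finally have "\<bar>\<eta>\<bar> * vnorm L.b \<le> 2 * \<rho> ^ (k - 1) * \<Delta> * vnorm L.b"
      by (rule mult_right_mono) simp
    thus ?thesis by (simp add: rt_b vnorm_smult mult_ac)
  qed

  \<comment> \<open>The eigenvector of the block matrix\<close>
  define y1 where "y1 = vec n (\<lambda>i. y $ i)"
  define y2 where "y2 = vec n (\<lambda>i. y $ (n + i))"
  define S where "S = four_block_mat Q (0\<^sub>m n k) (0\<^sub>m n k) Q"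
  have y12: "y1 \<in> carrier_vec n" "y2 \<in> carrier_vec n" by (simp_all add: y1_def y2_def)
  have y_app: "y = y1 @\<^sub>v y2" using y by (intro eq_vecI) (auto simp: y1_def y2_def)
  define c where "c = (g \<bullet> y2) / \<Delta>\<^sup>2"
  have By: "B *\<^sub>v y2 = y1" "B *\<^sub>v y1 = c \<cdot>\<^sub>v g"
    using Mmat_eigenvector_blocks[OF A g y12] y_eig unfolding y_app B_def c_def by auto
  have y2nz: "y2 \<noteq> 0\<^sub>v n"
  proof
    assume 0: "y2 = 0\<^sub>v n"
    hence "y1 = 0\<^sub>v n" using By(1) mv_zero[OF B.carrier] by simp
    hence "y \<bullet> y = 0" unfolding y_app 0 by (subst scalar_prod_append[of _ n _ n]) auto
    thus False using y_unit by (simp add: vnorm_def)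
  qed
  \<comment> \<open>From \<open>B y1 = c g\<close> and \<open>B xopt = - g\<close> follows
    \<open>y1 = - c xopt\<close>; inverting \<open>B\<close> once more gives
    \<open>y2\<close>.\<close>
  have y2z: "y2 = (- c) \<cdot>\<^sub>v z"
  proof -
    have "minv B *\<^sub>v (- g) = xopt" using B.minv_mult[OF xopt] by (simp add: Bx)
    hence gx: "minv B *\<^sub>v g = - xopt" using g by (simp add: mv_uminus) (metis uminus_uminus_vec)
    have "y1 = minv B *\<^sub>v (c \<cdot>\<^sub>v g)" using By(2) B.minv_mult[OF y12(1)] by simp
    also have "\<dots> = (- c) \<cdot>\<^sub>v xopt" using g by (simp add: mv_smult gx) (intro eq_vecI; simp)
    finally have "y1 = (- c) \<cdot>\<^sub>v xopt" .
    hence "y2 = minv B *\<^sub>v ((- c) \<cdot>\<^sub>v xopt)" using By(1) B.minv_mult[OF y12(2)] by simp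
    thus ?thesis using xopt by (simp add: mv_smult z_def)
  qed
  have cnz: "c \<noteq> 0"
  proof
    assume "c = 0"
    hence "y2 = 0\<^sub>v n" using z unfolding y2z by (intro eq_vecI) auto
    thus False using y2nz by simp
  qed
  have sin_y2: "sin_angle y2 Q = vnorm Pz / vnorm z"
    unfolding y2z using sin_angle_smult[OF Q z] cnz by (simp add: sin_angle_def Pz_def)
  have znz: "vnorm z > 0"
  proof (rule vnorm_pos[OF z])
    show "z \<noteq> 0\<^sub>v n" using y2nz unfolding y2z by auto
  qed
  have y2pos: "vnorm y2 > 0" using vnorm_pos[OF y12(2) y2nz] .
  \<comment> \<open>As \<open>y\<close> has norm 1, \<open>sin_angle y S\<close> is already the norm
    of the projection residual of \<open>y\<close>.\<close>
  have sin_le: "sin_angle y2 Q * vnorm y2 \<le> sin_angle y S"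
    using vnorm_proj_le_block[OF Q y12] y_unit y2pos unfolding y_app[symmetric] S_def[symmetric]
    by (simp add: sin_angle_def)

  \<comment> \<open>Assembly of the two inequalities\<close>
  define s where "s = vnorm z / (\<gamma> * E)"
  have s: "s \<ge> 0" using \<gamma> Epos by (simp add: s_def)
  have sin0: "sin_angle y2 Q \<ge> 0" by (simp add: sin_angle_def)
  have first: "lopt - lk \<le> s * (vnorm rt / \<gamma>) * sin_angle y2 Q"
  proof -
    \<comment> \<open>The numerator \<open>vnorm z\<close> of \<open>s\<close> cancels the
      denominator of the sine, since \<open>y2\<close> and \<open>z\<close> are parallel.\<close>
    have "s * (vnorm rt / \<gamma>) * sin_angle y2 Q = vnorm rt * vnorm Pz / (\<gamma>\<^sup>2 * E)"
      unfolding s_def sin_y2 using znz by (simp add: power2_eq_square)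
    thus ?thesis using gap \<gamma> Epos by (simp add: pos_le_divide_eq)
  qed
  have second: "s * (vnorm rt / \<gamma>) * sin_angle y2 Q
      \<le> s * (2 * vnorm L.b * \<Delta> / (vnorm y2 * \<gamma>)) * \<rho> ^ (k - 1) * sin_angle y S"
  proof -
    have "vnorm rt * sin_angle y2 Q \<le> (2 * vnorm L.b * \<Delta> * \<rho> ^ (k - 1)) * (sin_angle y S / vnorm y2)"
      using rt_le sin_le sin0 y2pos order_trans[OF vnorm_nonneg rt_le]
      by (intro mult_mono) (auto simp: pos_le_divide_eq)
    hence "s / \<gamma> * (vnorm rt * sin_angle y2 Q)
        \<le> s / \<gamma> * ((2 * vnorm L.b * \<Delta> * \<rho> ^ (k - 1)) * (sin_angle y S / vnorm y2))"
      using s \<gamma> by (intro mult_left_mono) auto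
    thus ?thesis by (simp add: mult_ac)
  qed
  from first second show ?thesis
    unfolding Let_def
    unfolding L.T_def[symmetric]
    unfolding L.b_def[symmetric] C_def[symmetric] B_def[symmetric]
    unfolding e1_def[symmetric] \<gamma>_def[symmetric] G_def[symmetric]
    unfolding ht_def[symmetric] y2_def[symmetric] S_def[symmetric] z_def[symmetric] E_def[symmetric]
      lo_def[symmetric] hi_def[symmetric]
    unfolding rt_def[symmetric] s_def[symmetric] \<rho>_def[symmetric]
    by (rule conjI)
qed

end
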